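(* Let $l\in\mathbb N$, $s\in\mathbb Z_{\geq0}$ with $s\neq l$, and a sign $\pm$. No left-moving tangency of the boundary curve $\partial L_{s,\pm}$ with the axis $\Lambda_l$ is a generalized simple intersection.
   Context: For $\omega>0$ and $(B,A)\in\mathbb R^2$ consider $\frac{d\varphi}{dt}=-\sin\varphi+B+A\cos\omega t$; with $\tau=\omega t$, $l=B/\omega$, $\mu=A/(2\omega)$ this gives the vector field $\dot\varphi=-\frac{\sin\varphi}{\omega}+l+2\mu\cos\tau$, $\dot\tau=1$ on the torus $\mathbb R^2/2\pi\mathbb Z^2$. The rotation number is $\rho(B,A;\omega)=\lim_{k\to+\infty}\varphi(2\pi k)/(2\pi k)$; for $s\in\mathbb Z$, $L_s(\omega)=\{\rho=s\}$ is the phase-lock area. The Poincaré map $h_{(B,A)}$ is the time-$2\pi$ flow map on $\{\tau=0\}$. $\partial L_{s,\pm}(\omega)$ is the set of points of $L_s(\omega)$ at which $h_{(B,A)}$ fixes $\pm\frac\pi2\pmod{2\pi}$ (an analytic curve; $\partial L_s=\partial L_{s,+}\cup\partial L_{s,-}$). A constriction is a point of some $L_s$ with $A\neq0$ at which $h_{(B,A)}$ is the identity. The axis is $\Lambda_l(\omega)=\{B=l\omega\}$. A generalized simple intersection is a point of $\Lambda_l(\omega)\cap\partial L_s(\omega)$ with $s\equiv l\pmod 2$ that is not a constriction. Left-moving tangency: let $\omega_0>0$, $l\in\mathbb N$, $\mu>0$, $B_0=l\omega_0$, $A_0=2\mu\omega_0$, $s\in\mathbb Z_{\geq0}$, and suppose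 $(B_0,A_0)\in\partial L_{s,\pm}(\omega_0)$, the curve $\partial L_{s,\pm}(\omega_0)$ is tangent to $\Lambda_l(\omega_0)$ at $(B_0,A_0)$, and the germ of $\partial L_{s,\pm}(\omega_0)$ at $(B_0,A_0)$ lies on the right of the line $\Lambda_l(\omega_0)$. Then $(B_0,A_0)$ is called a left-moving tangency (for $\omega=\omega_0$) if there is a neighborhood $U$ of $(B_0,A_0)$ such that for every $\omega>\omega_0$ close enough to $\omega_0$ (depending on $U$) the intersection $\partial L_{s,\pm}(\omega)\cap\Lambda_l(\omega)$ contains no points of $U$. *)

theory Defs
  imports "HOL-Analysis.Analysis"
begin

text \<open>Solution of the lifted equation on the torus in the time variable tau = omega t:
  d phi / d tau = (- sin phi + B + A cos tau) / omega,  phi(0) = x0.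
  (Equivalently dphi/dtau = - sin phi / omega + l + 2 mu cos tau with l = B/omega, mu = A/(2 omega).)\<close>
definition sol :: "real \<Rightarrow> real \<Rightarrow> real \<Rightarrow> real \<Rightarrow> real \<Rightarrow> real" where
  "sol \<omega> B A x0 = (THE \<phi>. \<phi> 0 = x0 \<and>
     (\<forall>\<tau>. (\<phi> has_real_derivative ((- sin (\<phi> \<tau>) + B + A * cos \<tau>) / \<omega>)) (at \<tau>)))"

definition poincare :: "real \<Rightarrow> real \<Rightarrow> real \<Rightarrow> real \<Rightarrow> real" where
  "poincare \<omega> B A x = sol \<omega> B A x (2 * pi)"

definition rot :: "real \<Rightarrow> real \<Rightarrow> real \<Rightarrow> real" where
  "rot \<omega> B A = lim (\<lambda>k::nat. sol \<omega> B A 0 (2 * pi * real k) / (2 * pi * real k))"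

definition phase_lock :: "real \<Rightarrow> int \<Rightarrow> (real \<times> real) set" where
  "phase_lock \<omega> s = {(B, A). rot \<omega> B A = of_int s}"

definition fixes_mod :: "(real \<Rightarrow> real) \<Rightarrow> real \<Rightarrow> bool" where
  "fixes_mod h x \<longleftrightarrow> (\<exists>k::int. h x = x + 2 * pi * of_int k)"

definition bdry_pm :: "real \<Rightarrow> int \<Rightarrow> bool \<Rightarrow> (real \<times> real) set" where
  "bdry_pm \<omega> s \<sigma> = {p \<in> phase_lock \<omega> s.
      fixes_mod (poincare \<omega> (fst p) (snd p)) (if \<sigma> then pi / 2 else - (pi / 2))}"

definition bdry :: "real \<Rightarrow> int \<Rightarrow> (real \<times> real) set" where
  "bdry \<omega> s = bdry_pm \<omega> s True \<union> bdry_pm \<omega> s False"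

definition constriction :: "real \<Rightarrow> real \<Rightarrow> real \<Rightarrow> bool" where
  "constriction \<omega> B A \<longleftrightarrow> (\<exists>s. (B, A) \<in> phase_lock \<omega> s) \<and> A \<noteq> 0 \<and>
     (\<forall>x. fixes_mod (poincare \<omega> B A) x)"

definition axis :: "real \<Rightarrow> int \<Rightarrow> (real \<times> real) set" where
  "axis \<omega> l = {(B, A). B = of_int l * \<omega>}"

definition gen_simple_intersection :: "real \<Rightarrow> int \<Rightarrow> real \<Rightarrow> real \<Rightarrow> bool" where
  "gen_simple_intersection \<omega> l B A \<longleftrightarrow>
     (B, A) \<in> axis \<omega> l \<and> (\<exists>s. s mod 2 = l mod 2 \<and> (B, A) \<in> bdry \<omega> s) \<and>
     \<not> constriction \<omega> B A"

text \<open>The set C is tangent at p to the vertical line through p (all secant directions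
  from p to nearby points of C become vertical).\<close>
definition tangent_vertical :: "(real \<times> real) set \<Rightarrow> real \<times> real \<Rightarrow> bool" where
  "tangent_vertical C p \<longleftrightarrow>
     (\<forall>\<epsilon>>0. \<exists>\<delta>>0. \<forall>q\<in>C. dist q p < \<delta> \<longrightarrow> \<bar>fst q - fst p\<bar> \<le> \<epsilon> * dist q p)"

definition germ_right :: "(real \<times> real) set \<Rightarrow> real \<times> real \<Rightarrow> bool" where
  "germ_right C p \<longleftrightarrow> (\<exists>\<delta>>0. \<forall>q\<in>C. dist q p < \<delta> \<longrightarrow> fst q \<ge> fst p)"

definition left_moving_tangency ::
  "real \<Rightarrow> nat \<Rightarrow> int \<Rightarrow> bool \<Rightarrow> real \<Rightarrow> real \<Rightarrow> bool" where
  "left_moving_tangency \<omega>0 l s \<sigma> B0 A0 \<longleftrightarrow>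
     \<omega>0 > 0 \<and> l \<ge> 1 \<and> s \<ge> 0 \<and>
     (\<exists>\<mu>>0. B0 = real l * \<omega>0 \<and> A0 = 2 * \<mu> * \<omega>0) \<and>
     (B0, A0) \<in> bdry_pm \<omega>0 s \<sigma> \<and>
     tangent_vertical (bdry_pm \<omega>0 s \<sigma>) (B0, A0) \<and>
     germ_right (bdry_pm \<omega>0 s \<sigma>) (B0, A0) \<and>
     (\<exists>U. open U \<and> (B0, A0) \<in> U \<and>
        (\<exists>\<epsilon>>0. \<forall>\<omega>. \<omega>0 < \<omega> \<and> \<omega> < \<omega>0 + \<epsilon> \<longrightarrow>
           bdry_pm \<omega> s \<sigma> \<inter> axis \<omega> (int l) \<inter> U = {}))"

end

theory Submission
  imports Defs "HOL-Complex_Analysis.Complex_Analysis" "Jordan_Normal_Form.Char_Poly"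
begin

text \<open>With \<open>z = exp (\<i> \<tau>)\<close> and \<open>\<kappa> = 1 / (2 \<omega>)\<close>, an orbit on the axis \<open>\<Lambda>\<^sub>l\<close> lifts to a complex function
  \<open>w\<close> with \<open>w' = \<kappa> exp (\<i> (l \<tau> + 2 \<mu> sin \<tau>)) cnj w\<close>, whose modulus squared \<open>E\<close> is the inverse of
  the fundamental solution of the variational equation; it solves a double confluent Heun equation. At a
  generalized simple intersection the orbit of \<open>\<plusminus> \<pi> / 2\<close> is closed and \<open>w\<close> is periodic. The recursion for
  the Fourier modes of \<open>w\<close> decouples at 0, so unless every orbit is closed (a constriction) only the
  nonnegative modes \<open>a\<^sub>n\<close> survive. Then the derivative of the time-\<open>2 \<pi>\<close> map in \<open>\<omega>\<close> along the axis is a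
  positive multiple of \<open>\<integral> E sin \<phi>\<close>, hence of \<open>\<Sum> n \<bar>a\<^sub>n\<bar>\<^sup>2 > 0\<close>: the displacement becomes positive at
  the tangency point as \<open>\<omega>\<close> grows. The germ lying on the right makes it nonpositive along the axis near
  the point for \<open>\<omega> = \<omega>0\<close>, and it is not identically zero there because at every zero \<open>- \<mu>\<close> is an
  eigenvalue of one of two fixed matrices. So by the intermediate value theorem an intersection with the
  axis persists for \<open>\<omega> > \<omega>0\<close>.\<close>

section \<open>The flow on the torus\<close>

text \<open>The coordinates \<open>a = 1 / \<omega>\<close>, \<open>b = B / \<omega>\<close>,
  \<open>c = A / \<omega>\<close> straighten the picture: the axis is \<open>b = l\<close> for every
  \<omega>, so raising \<omega> along it lowers \<open>a\<close> alone. The first-order sign at the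
  tangency point tells only to which side the displacement moves there; to trap a zero, a nearby
  point of the axis with the opposite strict sign is needed. There would be none if a whole segment
  of the axis belonged to the boundary curve, and it is the finiteness of a spectrum that excludes
  this. Three facts make \<open>w\<close> usable. Its phase is half an angle, so the parity of
  \<open>l - s\<close> decides between periodic and antiperiodic. The starting points are centres of
  a time-reversal symmetry, which makes the modulus periodic. Finally, \<open>w\<close> satisfies a
  first-order antilinear equation besides the linear second-order one: the linear one provides a
  mode recursion and a solution space of dimension two, the antilinear one rules out a
  \<open>w\<close> with nonpositive modes only and ties the mode \<open>n\<close> of
  \<open>exp (- \<mu> z) w\<close> to the mode \<open>l - n\<close>.\<close>

lemma abs_sin_diff_le: "\<bar>sin x - sin y\<bar> \<le> \<bar>x - y\<bar>" for x y :: real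
proof -
  have "\<bar>sin x - sin y\<bar> = 2 * (\<bar>sin ((x - y) / 2)\<bar> * \<bar>cos ((x + y) / 2)\<bar>)"
    by (simp add: sin_diff_sin abs_mult)
  also have "\<dots> \<le> 2 * (\<bar>(x - y) / 2\<bar> * 1)"
    by (intro mult_mono mult_left_mono abs_sin_x_le_abs_x) auto
  finally show ?thesis by simp
qed

lemma abs_cos_diff_le: "\<bar>cos x - cos y\<bar> \<le> \<bar>x - y\<bar>" for x y :: real
  using abs_sin_diff_le[of "pi / 2 - x" "pi / 2 - y"] by (simp add: sin_diff abs_minus_commute)

lemma sin_linearization: "\<bar>sin y - sin x - cos x * (y - x)\<bar> \<le> (y - x)\<^sup>2" for x y :: real
proof -
  have *: "\<bar>sin y - sin x - cos x * (y - x)\<bar> \<le> (y - x)\<^sup>2" if "x \<noteq> y" for x y :: real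
  proof -
    have "\<exists>z. \<bar>z - x\<bar> \<le> \<bar>y - x\<bar> \<and> sin y - sin x = (y - x) * cos z"
    proof (cases "x < y")
      case True
      from MVT2[OF True, of sin cos] obtain z where "x < z" "z < y" "sin y - sin x = (y - x) * cos z"
        by (auto intro: derivative_eq_intros)
      then show ?thesis by (intro exI[of _ z]) auto
    next
      case False
      with that have "y < x" by simp
      from MVT2[OF this, of sin cos] obtain z where "y < z" "z < x" "sin x - sin y = (x - y) * cos z"
        by (auto intro: derivative_eq_intros)
      then show ?thesis by (intro exI[of _ z]) (auto simp: algebra_simps)
    qed
    then obtain z where z: "\<bar>z - x\<bar> \<le> \<bar>y - x\<bar>" "sin y - sin x = (y - x) * cos z" by blast
    have "\<bar>sin y - sin x - cos x * (y - x)\<bar> = \<bar>y - x\<bar> * \<bar>cos z - cos x\<bar>"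
      by (simp add: z(2) abs_mult[symmetric] algebra_simps)
    also have "\<dots> \<le> \<bar>y - x\<bar> * \<bar>y - x\<bar>"
      using abs_cos_diff_le[of z x] z(1) by (intro mult_left_mono) auto
    finally show ?thesis by (simp add: power2_eq_square)
  qed
  show ?thesis using *[of x y] by (cases "x = y") auto
qed

lemma gronwall_zero:
  fixes q q' :: "real \<Rightarrow> real"
  assumes T: "0 \<le> T"
    and q: "\<And>t. 0 \<le> t \<Longrightarrow> t \<le> T \<Longrightarrow> (q has_real_derivative q' t) (at t)"
    and le: "\<And>t. 0 \<le> t \<Longrightarrow> t \<le> T \<Longrightarrow> q' t \<le> C * q t + k"
    and q0: "q 0 \<le> 0" and C: "0 \<le> C" and k: "0 \<le> k"
  shows "q T \<le> k * T * exp (C * T)"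
proof -
  \<comment> \<open>The exponential absorbs the growth rate \<open>C\<close>, the linear term the
    source \<open>k\<close>, whose damped size never exceeds \<open>k\<close>.\<close>
  define h where "h t = q t * exp (- C * t) - k * t" for t
  have "h T \<le> h 0"
  proof (rule DERIV_nonpos_imp_nonincreasing[OF T])
    fix t assume t: "0 \<le> t" "t \<le> T"
    have "(h has_real_derivative ((q' t - C * q t) * exp (- C * t) - k)) (at t)"
      unfolding h_def by (auto intro!: derivative_eq_intros q t simp: algebra_simps)
    moreover have "(q' t - C * q t) * exp (- C * t) - k \<le> 0"
    proof -
      have "(q' t - C * q t) * exp (- C * t) \<le> k * exp (- C * t)"
        using le[OF t] by (intro mult_right_mono) auto
      also have "\<dots> \<le> k * 1" using C k t by (intro mult_left_mono) auto
      finally show ?thesis by simp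
    qed
    ultimately show "\<exists>y. (h has_real_derivative y) (at t) \<and> y \<le> 0" by blast
  qed
  then have "q T * exp (- (C * T)) \<le> k * T" using q0 by (simp add: h_def)
  then have "q T * exp (- (C * T)) * exp (C * T) \<le> k * T * exp (C * T)"
    by (rule mult_right_mono) simp
  then show ?thesis by (simp add: exp_minus field_simps)
qed

definition torus_solution :: "real \<Rightarrow> real \<Rightarrow> real \<Rightarrow> (real \<Rightarrow> real) \<Rightarrow> bool" where
  "torus_solution a b c f \<longleftrightarrow>
     (\<forall>t. (f has_real_derivative (- a * sin (f t) + b + c * cos t)) (at t))"

lemma torus_solutionD:
  "torus_solution a b c f \<Longrightarrow> (f has_real_derivative (- a * sin (f t) + b + c * cos t)) (at t)"
  by (simp add: torus_solution_def)

lemma torus_solution_continuous_on: "torus_solution a b c f \<Longrightarrow> continuous_on S f"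
  by (meson DERIV_isCont continuous_at_imp_continuous_on torus_solutionD)

lemma torus_solution_unique:
  assumes f: "torus_solution a b c f" and g: "torus_solution a b c g" and eq: "f t0 = g t0"
  shows "f = g"
proof
  fix t
  \<comment> \<open>\<open>e = 1\<close> and \<open>e = - 1\<close> run time forwards and backwards
    from \<open>t0\<close>. The square of the difference is differentiable, its modulus need not
    be.\<close>
  have aux: "(f (t0 + e * T) - g (t0 + e * T))\<^sup>2 \<le> 0" if T: "T \<ge> 0" and e: "\<bar>e\<bar> = 1" for T e :: real
  proof -
    define d where "d t = f (t0 + e * t) - g (t0 + e * t)" for t
    define d' where "d' t = e * (- a * (sin (f (t0 + e * t)) - sin (g (t0 + e * t))))" for t
    have d: "(d has_real_derivative d' t) (at t)" for t
      unfolding d_def d'_def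
      by (rule derivative_eq_intros DERIV_chain2[OF torus_solutionD[OF f]]
          DERIV_chain2[OF torus_solutionD[OF g]] refl | simp add: algebra_simps)+
    have "(d T)\<^sup>2 \<le> 0 * T * exp (2 * \<bar>a\<bar> * T)"
    proof (rule gronwall_zero[OF T])
      show "((\<lambda>t. (d t)\<^sup>2) has_real_derivative 2 * d t * d' t) (at t)" for t
        by (auto intro!: derivative_eq_intros d)
      show "2 * d t * d' t \<le> 2 * \<bar>a\<bar> * (d t)\<^sup>2 + 0" for t
      proof -
        have "2 * d t * d' t \<le> 2 * \<bar>d t\<bar> * \<bar>d' t\<bar>" by (simp add: abs_mult[symmetric] mult.assoc)
        also have "\<dots> \<le> 2 * \<bar>d t\<bar> * (\<bar>a\<bar> * \<bar>d t\<bar>)"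
          unfolding d'_def abs_mult e d_def
          by (intro mult_left_mono) (auto intro!: mult_left_mono abs_sin_diff_le)
        also have "\<dots> = 2 * \<bar>a\<bar> * \<bar>d t\<bar>\<^sup>2" by (simp only: power2_eq_square mult_ac)
        finally show ?thesis by simp
      qed
    qed (auto simp: d_def eq)
    then show ?thesis by (simp add: d_def)
  qed
  show "f t = g t"
  proof (cases "t \<ge> t0")
    case True
    then show ?thesis using aux[of "t - t0" 1] by simp
  next
    case False
    then show ?thesis using aux[of "t0 - t" "-1"] by simp
  qed
qed

lemma antiderivative_UNIV:
  fixes g :: "real \<Rightarrow> real"
  assumes "continuous_on UNIV g"
  obtains G where "G 0 = 0" "\<And>t. (G has_real_derivative g t) (at t)"
proof -
  from einterval_antiderivative[of "-\<infinity>" "\<infinity>" g] assms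
  obtain F where F: "\<And>t. (F has_vector_derivative g t) (at t)"
    by (auto simp: continuous_on_eq_continuous_at)
  show thesis
  proof (rule that[of "\<lambda>t. F t - F 0"])
    show "((\<lambda>t. F t - F 0) has_real_derivative g t) (at t)" for t
      using F[of t] by (auto intro!: derivative_eq_intros simp: has_real_derivative_iff_has_vector_derivative)
  qed simp
qed

text \<open>Integrating the weight \<open>exp (2 L \<bar>t\<bar>)\<close> gains the factor 1 / (2
  L); against the Lipschitz constant \<open>L\<close> this leaves the contraction factor 1/2 of the
  Picard iteration.\<close>

lemma abs_le_exp_bound:
  fixes D D' :: "real \<Rightarrow> real"
  assumes D: "\<And>t. (D has_real_derivative D' t) (at t)" and D0: "D 0 = 0"
    and le: "\<And>t. \<bar>D' t\<bar> \<le> L * K * exp (2 * L * \<bar>t\<bar>)"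
  shows "\<bar>D t\<bar> \<le> K / 2 * (exp (2 * L * \<bar>t\<bar>) - 1)"
proof -
  have aux: "\<bar>D (e * T)\<bar> \<le> K / 2 * (exp (2 * L * T) - 1)" if T: "T > 0" and e: "\<bar>e\<bar> = 1" for T e :: real
  proof -
    have d: "((\<lambda>t. D (e * t)) has_real_derivative e * D' (e * t)) (at t)" for t
    proof -
      have "((\<lambda>t. e * t) has_real_derivative e) (at t)" by (auto intro!: derivative_eq_intros)
      from DERIV_chain2[where f = D, OF D this] show ?thesis by (simp add: mult.commute)
    qed
    have p: "((\<lambda>t. K / 2 * exp (2 * L * t)) has_real_derivative L * K * exp (2 * L * t)) (at t)" for t
      by (auto intro!: derivative_eq_intros)
    have "norm (D (e * T) - D (e * 0)) \<le> K / 2 * exp (2 * L * T) - K / 2 * exp (2 * L * 0)"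
    proof (rule differentiable_bound_general[OF T])
      show "continuous_on {0..T} (\<lambda>t. D (e * t))" "continuous_on {0..T} (\<lambda>t. K / 2 * exp (2 * L * t))"
        using d p by (meson DERIV_isCont continuous_at_imp_continuous_on)+
      show "((\<lambda>t. D (e * t)) has_vector_derivative e * D' (e * t)) (at t)" for t
        using d by (simp add: has_real_derivative_iff_has_vector_derivative)
      show "((\<lambda>t. K / 2 * exp (2 * L * t)) has_vector_derivative L * K * exp (2 * L * t)) (at t)" for t
        using p by (simp add: has_real_derivative_iff_has_vector_derivative)
      show "norm (e * D' (e * t)) \<le> L * K * exp (2 * L * t)" if "0 < t" for t
        using le[of "e * t"] that e by (simp add: abs_mult)
    qed
    then show ?thesis using D0 by (simp add: algebra_simps)
  qed
  show ?thesis
    using aux[of t 1] aux[of "- t" "-1"] D0 by (cases "t > 0"; cases "t = 0") auto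
qed

text \<open>Picard iteration contracts by a factor 1/2 in the supremum norm weighted by
  \<open>exp (-2 L \<bar>t\<bar>)\<close>, so one fixed point gives the solution on the whole line.\<close>
lemma torus_solution_exists: "\<exists>f. f 0 = x0 \<and> torus_solution a b c f"
proof -
  \<comment> \<open>The field has Lipschitz constant \<open>\<bar>a\<bar>\<close>; the summand 1
    keeps \<open>L\<close> positive when \<open>a = 0\<close>.\<close>
  define L where "L = \<bar>a\<bar> + 1"
  have L: "L > 0" by (simp add: L_def add_nonneg_pos)
  \<comment> \<open>The unknown \<open>u\<close> is the deviation from \<open>x0\<close> divided by
    the weight, so that it is bounded and lives in a complete space.\<close>
  define rhs where "rhs u t = - a * sin (x0 + exp (2 * L * \<bar>t\<bar>) * apply_bcontfun u t) + b + c * cos t"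
    for u :: "real \<Rightarrow>\<^sub>C real" and t
  have rhs_cont: "continuous_on UNIV (rhs u)" for u
    unfolding rhs_def using continuous_on_apply_bcontfun[of UNIV u] by (intro continuous_intros)
  have "\<exists>G. G 0 = 0 \<and> (\<forall>t. (G has_real_derivative rhs u t) (at t))" for u
    using antiderivative_UNIV[OF rhs_cont] by metis
  then obtain G where G0: "\<And>u. G u 0 = 0" and G: "\<And>u t. (G u has_real_derivative rhs u t) (at t)"
    by metis
  define T where "T u t = exp (- (2 * L * \<bar>t\<bar>)) * G u t" for u t
  have weight: "\<bar>exp (- (2 * L * \<bar>t\<bar>)) * D t\<bar> \<le> K / 2"
    if "\<And>t. (D has_real_derivative D' t) (at t)" "D 0 = 0"
      "\<And>t. \<bar>D' t\<bar> \<le> L * K * exp (2 * L * \<bar>t\<bar>)" "K \<ge> 0" for D D' K t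
  proof -
    have "\<bar>exp (- (2 * L * \<bar>t\<bar>)) * D t\<bar> = exp (- (2 * L * \<bar>t\<bar>)) * \<bar>D t\<bar>" by (simp add: abs_mult)
    also have "\<dots> \<le> exp (- (2 * L * \<bar>t\<bar>)) * (K / 2 * (exp (2 * L * \<bar>t\<bar>) - 1))"
      by (intro mult_left_mono abs_le_exp_bound[OF that(1-3)]) auto
    also have "\<dots> = K / 2 * (1 - exp (- (2 * L * \<bar>t\<bar>)))" by (simp add: exp_minus field_simps)
    also have "\<dots> \<le> K / 2 * 1" using that(4) by (intro mult_left_mono) auto
    finally show ?thesis by simp
  qed
  have T_mem: "T u \<in> bcontfun" for u
  proof (rule bcontfun_normI)
    have "continuous_on UNIV (G u)"
      using G by (meson DERIV_isCont continuous_at_imp_continuous_on)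
    then show "continuous_on UNIV (T u)" unfolding T_def by (intro continuous_intros)
    fix t
    let ?M = "\<bar>a\<bar> + \<bar>b\<bar> + \<bar>c\<bar>"
    have "\<bar>rhs u t\<bar> \<le> L * (?M / L) * exp (2 * L * \<bar>t\<bar>)" for t
    proof -
      have "\<bar>rhs u t\<bar> \<le> \<bar>a * sin (x0 + exp (2 * L * \<bar>t\<bar>) * apply_bcontfun u t)\<bar> + \<bar>b\<bar> + \<bar>c * cos t\<bar>"
        unfolding rhs_def by linarith
      also have "\<dots> \<le> \<bar>a\<bar> * 1 + \<bar>b\<bar> + \<bar>c\<bar> * 1"
        unfolding abs_mult by (intro add_mono mult_left_mono) auto
      also have "\<dots> \<le> ?M * exp (2 * L * \<bar>t\<bar>)"
        using L mult_left_mono[of 1 "exp (2 * L * \<bar>t\<bar>)" ?M] by simp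
      finally show ?thesis using L by simp
    qed
    then show "norm (T u t) \<le> ?M / L / 2"
      unfolding T_def real_norm_def using L by (intro weight[OF G G0]) auto
  qed
  have contr: "dist (Bcontfun (T u)) (Bcontfun (T v)) \<le> 1 / 2 * dist u v" for u v
  proof (rule dist_bound)
    fix t
    have "\<bar>exp (- (2 * L * \<bar>t\<bar>)) * (G u t - G v t)\<bar> \<le> dist u v / 2"
    proof (rule weight)
      show "((\<lambda>t. G u t - G v t) has_real_derivative rhs u t - rhs v t) (at t)" for t
        by (auto intro!: derivative_eq_intros G)
      show "\<bar>rhs u t - rhs v t\<bar> \<le> L * dist u v * exp (2 * L * \<bar>t\<bar>)" for t
      proof -
        let ?U = "x0 + exp (2 * L * \<bar>t\<bar>) * apply_bcontfun u t"
        let ?V = "x0 + exp (2 * L * \<bar>t\<bar>) * apply_bcontfun v t"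
        have "\<bar>rhs u t - rhs v t\<bar> = \<bar>a\<bar> * \<bar>sin ?U - sin ?V\<bar>"
          by (simp add: rhs_def abs_mult[symmetric] abs_minus_commute algebra_simps)
        also have "\<dots> \<le> \<bar>a\<bar> * \<bar>?U - ?V\<bar>" by (intro mult_left_mono abs_sin_diff_le) auto
        also have "\<bar>?U - ?V\<bar> = exp (2 * L * \<bar>t\<bar>) * dist (apply_bcontfun u t) (apply_bcontfun v t)"
        proof -
          have "?U - ?V = exp (2 * L * \<bar>t\<bar>) * (apply_bcontfun u t - apply_bcontfun v t)"
            by (simp add: algebra_simps)
          then show ?thesis by (simp add: dist_real_def abs_mult)
        qed
        also have "\<bar>a\<bar> * \<dots> \<le> L * (exp (2 * L * \<bar>t\<bar>) * dist u v)"
          by (intro mult_mono dist_bounded) (auto simp: L_def)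
        finally show ?thesis by (simp add: mult_ac)
      qed
    qed (auto simp: G0)
    then show "dist (apply_bcontfun (Bcontfun (T u)) t) (apply_bcontfun (Bcontfun (T v)) t) \<le> 1 / 2 * dist u v"
      by (simp add: Bcontfun_inverse T_mem T_def dist_real_def algebra_simps)
  qed
  obtain u where u: "Bcontfun (T u) = u"
    using banach_fix_type[of "1/2" "\<lambda>u. Bcontfun (T u)"] contr by auto
  have uT: "apply_bcontfun u t = T u t" for t
    using u Bcontfun_inverse[OF T_mem] by metis
  have eq: "x0 + exp (2 * L * \<bar>t\<bar>) * apply_bcontfun u t = x0 + G u t" for t
    by (simp add: uT T_def exp_minus field_simps)
  have "((\<lambda>t. x0 + G u t) has_real_derivative - a * sin (x0 + G u t) + b + c * cos t) (at t)" for t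
    using G[of u t] by (auto intro!: derivative_eq_intros simp: rhs_def eq)
  then show ?thesis
    by (intro exI[of _ "\<lambda>t. x0 + G u t"]) (simp add: torus_solution_def G0)
qed

definition torus_flow :: "real \<Rightarrow> real \<Rightarrow> real \<Rightarrow> real \<Rightarrow> real \<Rightarrow> real" where
  "torus_flow a b c x = (SOME f. f 0 = x \<and> torus_solution a b c f)"

lemma torus_flow_0 [simp]: "torus_flow a b c x 0 = x"
  and torus_flow_solution: "torus_solution a b c (torus_flow a b c x)"
  using someI_ex[OF torus_solution_exists, of x a b c] by (simp_all add: torus_flow_def)

lemma sol_eq_torus_flow:
  "sol \<omega> B A x = torus_flow (1 / \<omega>) (B / \<omega>) (A / \<omega>) x"
proof -
  have eq: "((- sin (f \<tau>) + B + A * cos \<tau>) / \<omega>) = - (1 / \<omega>) * sin (f \<tau>) + B / \<omega> + A / \<omega> * cos \<tau>"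
    for f :: "real \<Rightarrow> real" and \<tau> by (simp add: add_divide_distrib diff_divide_distrib)
  show ?thesis
    unfolding sol_def eq torus_solution_def[symmetric]
  proof (rule the_equality)
    fix f assume "f 0 = x \<and> torus_solution (1 / \<omega>) (B / \<omega>) (A / \<omega>) f"
    then show "f = torus_flow (1 / \<omega>) (B / \<omega>) (A / \<omega>) x"
      by (intro torus_solution_unique[OF _ torus_flow_solution, where ?t0.0 = 0]) auto
  qed (simp add: torus_flow_solution)
qed

text \<open>The field is invariant under full turns of time and of phase, so the shifted orbit is
  again a solution, and it agrees with \<open>f\<close> at 0.\<close>

lemma torus_solution_shift:
  assumes f: "torus_solution a b c f" and per: "f (2 * pi) = f 0 + 2 * pi * of_int k"
  shows "f (t + 2 * pi) = f t + 2 * pi * of_int k"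
proof -
  have sin_shift: "sin (x + 2 * pi * of_int k) = sin x" for x :: real
    using sin_cos_eq_iff[of "x + 2 * pi * of_int k" x] by (metis mult.commute)
  have "torus_solution a b c (\<lambda>t. f (t + 2 * pi) - 2 * pi * of_int k)"
    unfolding torus_solution_def
  proof
    fix t
    have "((\<lambda>t. f (t + 2 * pi) - 2 * pi * of_int k) has_real_derivative
       - a * sin (f (t + 2 * pi)) + b + c * cos (t + 2 * pi)) (at t)"
      by (rule derivative_eq_intros DERIV_chain2[OF torus_solutionD[OF f]] refl | simp)+
    moreover have "sin (f (t + 2 * pi) - 2 * pi * of_int k) = sin (f (t + 2 * pi))"
      using sin_shift[of "f (t + 2 * pi) - 2 * pi * of_int k"] by simp
    ultimately show "((\<lambda>t. f (t + 2 * pi) - 2 * pi * of_int k) has_real_derivative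
       - a * sin (f (t + 2 * pi) - 2 * pi * of_int k) + b + c * cos t) (at t)"
      by simp
  qed
  from torus_solution_unique[OF this f, of 0] per
  have "(\<lambda>t. f (t + 2 * pi) - 2 * pi * of_int k) = f" by simp
  from fun_cong[OF this, of t] show ?thesis by simp
qed

lemma torus_solution_add_period:
  assumes f: "torus_solution a b c f"
  shows "torus_solution a b c (\<lambda>t. f t + 2 * pi * of_int k)"
proof -
  have "sin (x + 2 * pi * of_int k) = sin x" for x :: real
    using sin_cos_eq_iff[of "x + 2 * pi * of_int k" x] by (metis mult.commute)
  then show ?thesis using f unfolding torus_solution_def
    by (auto intro!: derivative_eq_intros)
qed

text \<open>Orbits that met would coincide by uniqueness, so they keep their order.\<close>

lemma torus_solution_mono:
  assumes f: "torus_solution a b c f" and g: "torus_solution a b c g" and le: "f 0 \<le> g 0" and t: "0 \<le> t"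
  shows "f t \<le> g t"
proof (rule ccontr)
  assume "\<not> f t \<le> g t"
  then have "\<exists>x\<ge>0. x \<le> t \<and> f x - g x = 0"
    using le t by (intro IVT') (auto intro!: continuous_intros torus_solution_continuous_on[OF f] torus_solution_continuous_on[OF g])
  then obtain x where "f x = g x" by auto
  from torus_solution_unique[OF f g this] \<open>\<not> f t \<le> g t\<close> show False by simp
qed

text \<open>The orbit of 0 stays between two translates of \<open>f\<close> by full turns, hence at
  bounded distance from \<open>f\<close>, and dividing by time removes the difference.\<close>

lemma rot_eq_of_periodic:
  assumes f: "torus_solution (1 / \<omega>) (B / \<omega>) (A / \<omega>) f" and per: "f (2 * pi) = f 0 + 2 * pi * of_int k"
  shows "rot \<omega> B A = of_int k"
proof -
  define g where "g = sol \<omega> B A 0"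
  have g: "torus_solution (1 / \<omega>) (B / \<omega>) (A / \<omega>) g" and g0: "g 0 = 0"
    by (simp_all add: g_def sol_eq_torus_flow torus_flow_solution)
  have fn: "f (2 * pi * real n) = f 0 + 2 * pi * of_int k * real n" for n
  proof (induction n)
    case (Suc n)
    have "f (2 * pi * real (Suc n)) = f (2 * pi * real n + 2 * pi)" by (simp add: algebra_simps)
    also have "\<dots> = f (2 * pi * real n) + 2 * pi * of_int k" by (rule torus_solution_shift[OF f per])
    finally show ?case using Suc by (simp add: algebra_simps)
  qed simp
  obtain m :: int where m: "\<bar>f 0\<bar> \<le> 2 * pi * of_int m"
  proof -
    obtain m :: int where "\<bar>f 0\<bar> / (2 * pi) \<le> of_int m" using ex_le_of_int by blast
    then show thesis by (intro that[of m]) (simp add: field_simps)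
  qed
  \<comment> \<open>One half bounds the distance of the two orbits, the other half the initial value
    \<open>f 0\<close>.\<close>
  define C where "C = 4 * pi * real_of_int m"
  have bound: "\<bar>g t - f t\<bar> \<le> 2 * pi * of_int m" if t: "t \<ge> 0" for t
  proof -
    have "f t + 2 * pi * of_int (- m) \<le> g t"
      by (rule torus_solution_mono[OF torus_solution_add_period[OF f] g _ t]) (use m g0 in auto)
    moreover have "g t \<le> f t + 2 * pi * of_int m"
      by (rule torus_solution_mono[OF g torus_solution_add_period[OF f] _ t]) (use m g0 in auto)
    ultimately show ?thesis by simp
  qed
  have lim: "(\<lambda>n::nat. g (2 * pi * real n) / (2 * pi * real n)) \<longlonglongrightarrow> of_int k"
  proof (rule LIMSEQ_I)
    fix r :: real assume r: "r > 0"
    obtain N :: nat where N: "real N > (C + 1) / (2 * pi * r)" using reals_Archimedean2 by blast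
    have C0: "C \<ge> 0" using m by (simp add: C_def)
    have Npos: "real N > 0" using N C0 r by (smt (verit) divide_nonneg_nonneg mult_nonneg_nonneg pi_ge_zero)
    show "\<exists>no. \<forall>n\<ge>no. norm (g (2 * pi * real n) / (2 * pi * real n) - of_int k) < r"
    proof (intro exI[of _ N] allI impI)
      fix n assume n: "N \<le> n"
      then have npos: "real n > 0" using Npos by linarith
      have "\<bar>g (2 * pi * real n) - 2 * pi * of_int k * real n\<bar> \<le> C"
        using bound[of "2 * pi * real n"] fn[of n] m npos unfolding C_def by simp
      then have "\<bar>g (2 * pi * real n) / (2 * pi * real n) - of_int k\<bar> \<le> C / (2 * pi * real n)"
      proof -
        have "g (2 * pi * real n) / (2 * pi * real n) - of_int k
            = (g (2 * pi * real n) - 2 * pi * of_int k * real n) / (2 * pi * real n)"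
          using npos by (simp add: field_simps)
        moreover assume "\<bar>g (2 * pi * real n) - 2 * pi * of_int k * real n\<bar> \<le> C"
        ultimately show ?thesis using npos by (simp add: divide_right_mono)
      qed
      also have "C / (2 * pi * real n) < r"
      proof -
        have "C + 1 < real N * (2 * pi * r)" using N r by (simp add: field_simps)
        also have "\<dots> \<le> real n * (2 * pi * r)" using n r by (intro mult_right_mono) auto
        finally show ?thesis using npos by (simp add: field_simps)
      qed
      finally show "norm (g (2 * pi * real n) / (2 * pi * real n) - of_int k) < r" by simp
    qed
  qed
  show ?thesis unfolding rot_def g_def[symmetric] by (rule limI[OF lim])
qed

text \<open>A closed orbit has its number of turns as rotation number, so lying in the phase-lock
  area fixes that number. From here on the limit in \<open>rot\<close> is replaced by one equation
  for the time-2 pi map.\<close>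

lemma mem_bdry_pm_iff:
  "(B, A) \<in> bdry_pm \<omega> s \<sigma> \<longleftrightarrow>
     torus_flow (1 / \<omega>) (B / \<omega>) (A / \<omega>) (if \<sigma> then pi / 2 else - (pi / 2)) (2 * pi)
       = (if \<sigma> then pi / 2 else - (pi / 2)) + 2 * pi * of_int s"
    (is "_ \<longleftrightarrow> ?f (2 * pi) = ?x + _")
proof
  assume "(B, A) \<in> bdry_pm \<omega> s \<sigma>"
  then obtain k :: int where k: "?f (2 * pi) = ?x + 2 * pi * of_int k" and rot: "rot \<omega> B A = of_int s"
    unfolding bdry_pm_def phase_lock_def fixes_mod_def poincare_def sol_eq_torus_flow by auto
  from rot_eq_of_periodic[OF torus_flow_solution, of \<omega> B A ?x k] k rot
  show "?f (2 * pi) = ?x + 2 * pi * of_int s" by simp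
next
  assume *: "?f (2 * pi) = ?x + 2 * pi * of_int s"
  from rot_eq_of_periodic[OF torus_flow_solution, of \<omega> B A ?x s] *
  have "rot \<omega> B A = of_int s" by simp
  with * show "(B, A) \<in> bdry_pm \<omega> s \<sigma>"
    unfolding bdry_pm_def phase_lock_def fixes_mod_def poincare_def sol_eq_torus_flow by auto
qed

section \<open>Continuous and first-order dependence on the parameters\<close>

lemma gronwall_abs:
  fixes d d' :: "real \<Rightarrow> real"
  assumes T: "0 \<le> T"
    and d: "\<And>t. 0 \<le> t \<Longrightarrow> t \<le> T \<Longrightarrow> (d has_real_derivative d' t) (at t)"
    and le: "\<And>t. 0 \<le> t \<Longrightarrow> t \<le> T \<Longrightarrow> \<bar>d' t\<bar> \<le> C * \<bar>d t\<bar> + k"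
    and d0: "d 0 = 0" and C: "0 \<le> C" and k: "0 \<le> k"
  shows "\<bar>d T\<bar> \<le> sqrt (T * exp ((2 * C + 1) * T)) * k"
proof -
  \<comment> \<open>Squaring avoids the corner of the modulus; the summand 1 in the exponent pays
    for estimating \<open>2 \<bar>d\<bar> k\<close> by the sum of the two squares.\<close>
  have "(d T)\<^sup>2 \<le> k\<^sup>2 * T * exp ((2 * C + 1) * T)"
  proof (rule gronwall_zero[OF T])
    fix t assume t: "0 \<le> t" "t \<le> T"
    show "((\<lambda>t. (d t)\<^sup>2) has_real_derivative 2 * d t * d' t) (at t)"
      by (auto intro!: derivative_eq_intros d t)
    have "2 * d t * d' t \<le> 2 * (\<bar>d t\<bar> * \<bar>d' t\<bar>)" by (simp add: abs_mult[symmetric] mult.assoc)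
    also have "\<dots> \<le> 2 * (\<bar>d t\<bar> * (C * \<bar>d t\<bar> + k))"
      by (intro mult_left_mono le t) auto
    also have "\<dots> = 2 * C * \<bar>d t\<bar>\<^sup>2 + 2 * \<bar>d t\<bar> * k" by (simp add: power2_eq_square algebra_simps)
    also have "\<dots> \<le> 2 * C * \<bar>d t\<bar>\<^sup>2 + (\<bar>d t\<bar>\<^sup>2 + k\<^sup>2)"
      using sum_squares_bound[of "\<bar>d t\<bar>" k] by simp
    finally show "2 * d t * d' t \<le> (2 * C + 1) * (d t)\<^sup>2 + k\<^sup>2" by (simp add: algebra_simps)
  qed (use d0 C in auto)
  then have "sqrt ((d T)\<^sup>2) \<le> sqrt (k\<^sup>2 * T * exp ((2 * C + 1) * T))" by (rule real_sqrt_le_mono)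
  also have "\<dots> = sqrt (T * exp ((2 * C + 1) * T)) * k"
    using k by (simp add: real_sqrt_mult algebra_simps)
  finally show ?thesis by simp
qed

text \<open>The difference of the fields is split so that \<open>a' - a\<close> multiplies the
  bounded \<open>sin (g t)\<close>. The constant therefore involves \<open>a\<close> only and is
  uniform in the perturbed parameters.\<close>

lemma torus_solution_lipschitz:
  assumes f: "torus_solution a b c f" and g: "torus_solution a' b' c' g" and eq: "g 0 = f 0" and t: "0 \<le> t"
  shows "\<bar>g t - f t\<bar> \<le> sqrt (t * exp ((2 * \<bar>a\<bar> + 1) * t)) * (\<bar>a' - a\<bar> + \<bar>b' - b\<bar> + \<bar>c' - c\<bar>)"
proof -
  define d' where "d' t = (- a' * sin (g t) + b' + c' * cos t) - (- a * sin (f t) + b + c * cos t)" for t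
  show ?thesis
  proof (rule gronwall_abs[OF t, where d' = d'])
    show "((\<lambda>t. g t - f t) has_real_derivative d' t) (at t)" for t
      unfolding d'_def by (intro DERIV_diff torus_solutionD f g)
    show "\<bar>d' t\<bar> \<le> \<bar>a\<bar> * \<bar>g t - f t\<bar> + (\<bar>a' - a\<bar> + \<bar>b' - b\<bar> + \<bar>c' - c\<bar>)" for t
    proof -
      have "d' t = - (a * (sin (g t) - sin (f t))) - (a' - a) * sin (g t) + (b' - b) + (c' - c) * cos t"
        by (simp add: d'_def algebra_simps)
      then have "\<bar>d' t\<bar> \<le> \<bar>a * (sin (g t) - sin (f t))\<bar> + \<bar>(a' - a) * sin (g t)\<bar> + \<bar>b' - b\<bar> + \<bar>(c' - c) * cos t\<bar>"
        by linarith
      also have "\<dots> \<le> \<bar>a\<bar> * \<bar>g t - f t\<bar> + \<bar>a' - a\<bar> * 1 + \<bar>b' - b\<bar> + \<bar>c' - c\<bar> * 1"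
        unfolding abs_mult by (intro add_mono mult_left_mono abs_sin_diff_le order.refl) auto
      finally show ?thesis by simp
    qed
  qed (use eq in auto)
qed

lemma tendsto_torus_flow:
  assumes A: "(A \<longlongrightarrow> a) F" and B: "(B \<longlongrightarrow> b) F" and C: "(C \<longlongrightarrow> c) F" and t: "0 \<le> t"
  shows "((\<lambda>x. torus_flow (A x) (B x) (C x) y t) \<longlongrightarrow> torus_flow a b c y t) F"
proof -
  define K where "K = sqrt (t * exp ((2 * \<bar>a\<bar> + 1) * t))"
  have "((\<lambda>x. torus_flow (A x) (B x) (C x) y t - torus_flow a b c y t) \<longlongrightarrow> 0) F"
  proof (rule Lim_null_comparison)
    have "((\<lambda>x. K * (\<bar>A x - a\<bar> + \<bar>B x - b\<bar> + \<bar>C x - c\<bar>)) \<longlongrightarrow> K * (\<bar>a - a\<bar> + \<bar>b - b\<bar> + \<bar>c - c\<bar>)) F"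
      by (intro tendsto_intros A B C)
    then show "((\<lambda>x. K * (\<bar>A x - a\<bar> + \<bar>B x - b\<bar> + \<bar>C x - c\<bar>)) \<longlongrightarrow> 0) F" by simp
    show "\<forall>\<^sub>F x in F. norm (torus_flow (A x) (B x) (C x) y t - torus_flow a b c y t)
        \<le> K * (\<bar>A x - a\<bar> + \<bar>B x - b\<bar> + \<bar>C x - c\<bar>)"
      unfolding K_def real_norm_def
      by (intro always_eventually allI torus_solution_lipschitz torus_flow_solution t) simp
  qed
  then show ?thesis by (simp add: LIM_zero_iff)
qed

lemma continuous_on_torus_flow:
  assumes "continuous_on S A" "continuous_on S B" "continuous_on S C" "0 \<le> t"
  shows "continuous_on S (\<lambda>x. torus_flow (A x) (B x) (C x) y t)"
  using assms unfolding continuous_on_def by (auto intro!: tendsto_torus_flow)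

text \<open>\<open>E\<close> is the integrating factor of the linearised equation
  \<open>y' = - a cos f y + r\<close>: the derivative of \<open>E y\<close> is
  \<open>E r\<close>.\<close>

definition variation_weight :: "real \<Rightarrow> (real \<Rightarrow> real) \<Rightarrow> (real \<Rightarrow> real) \<Rightarrow> bool" where
  "variation_weight a f E \<longleftrightarrow>
     E 0 = 1 \<and> (\<forall>t. E t > 0 \<and> (E has_real_derivative a * cos (f t) * E t) (at t))"

lemma variation_weight_exists:
  assumes "continuous_on UNIV f"
  obtains E where "variation_weight a f E"
proof -
  have "continuous_on UNIV (\<lambda>t. a * cos (f t))" by (intro continuous_intros assms)
  from antiderivative_UNIV[OF this] obtain G
    where G: "G 0 = 0" "\<And>t. (G has_real_derivative a * cos (f t)) (at t)" by metis
  show thesis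
    by (rule that[of "\<lambda>t. exp (G t)"])
      (auto simp: variation_weight_def G(1) intro!: derivative_eq_intros G(2))
qed

lemma variation_weight_continuous_on: "variation_weight a f E \<Longrightarrow> continuous_on S E"
  unfolding variation_weight_def by (meson DERIV_isCont continuous_at_imp_continuous_on)

text \<open>After multiplication by \<open>E\<close> the terms linear in the displacement cancel,
  and the forcing integrates to \<open>J\<close>. \<open>K\<close> precedes the perturbed parameters
  because it must serve all of them; \<open>J\<close> enters through its derivative so that any
  antiderivative can be supplied.\<close>

lemma flow_first_order:
  assumes f: "torus_solution a b c f" and E: "variation_weight a f E" and T: "0 < T"
  obtains K where "0 \<le> K" "\<And>a' b' c' g J. torus_solution a' b' c' g \<Longrightarrow> g 0 = f 0 \<Longrightarrow> J 0 = 0 \<Longrightarrow>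
     (\<And>t. (J has_real_derivative E t * (- (a' - a) * sin (f t) + (b' - b) + (c' - c) * cos t)) (at t)) \<Longrightarrow>
     \<bar>E T * (g T - f T) - J T\<bar> \<le> K * (\<bar>a' - a\<bar> + \<bar>b' - b\<bar> + \<bar>c' - c\<bar>)\<^sup>2"
proof -
  define L where "L = sqrt (T * exp ((2 * \<bar>a\<bar> + 1) * T))"
  have L0: "L \<ge> 0" using T by (simp add: L_def)
  obtain M where M: "\<And>t. t \<in> {0..T} \<Longrightarrow> E t \<le> M"
    using compact_continuous_image[OF variation_weight_continuous_on[OF E], of "{0..T}"]
    by (meson bounded_imp_bdd_above cSUP_upper compact_Icc compact_imp_bounded)
  have Epos: "E t > 0" and E': "(E has_real_derivative a * cos (f t) * E t) (at t)" for t
    using E by (auto simp: variation_weight_def)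
  have M0: "M \<ge> 0" using M[of 0] Epos[of 0] T by auto
  show thesis
  proof (rule that[of "M * (\<bar>a\<bar> * L\<^sup>2 + L) * T"])
    show "0 \<le> M * (\<bar>a\<bar> * L\<^sup>2 + L) * T" using M0 L0 T by auto
  next
    fix a' b' c' and g J :: "real \<Rightarrow> real"
    assume g: "torus_solution a' b' c' g" and g0: "g 0 = f 0" and J0: "J 0 = 0"
      and J: "\<And>t. (J has_real_derivative E t * (- (a' - a) * sin (f t) + (b' - b) + (c' - c) * cos t)) (at t)"
    define \<delta> where "\<delta> = \<bar>a' - a\<bar> + \<bar>b' - b\<bar> + \<bar>c' - c\<bar>"
    have \<delta>: "0 \<le> \<delta>" "\<bar>a' - a\<bar> \<le> \<delta>" by (simp_all add: \<delta>_def)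
    \<comment> \<open>What remains is quadratic in the perturbation: the Taylor remainder of the
      sine, and the product of \<open>a' - a\<close> with a displacement that is itself of first
      order.\<close>
    define R where "R t = E t * (- a * (sin (g t) - sin (f t) - cos (f t) * (g t - f t)) - (a' - a) * (sin (g t) - sin (f t)))" for t
    define H where "H t = E t * (g t - f t) - J t" for t
    have H: "(H has_real_derivative R t) (at t)" for t
      unfolding H_def R_def
      by (rule derivative_eq_intros E' torus_solutionD[OF f] torus_solutionD[OF g] J refl)+
        (simp add: algebra_simps)
    have R: "\<bar>R t\<bar> \<le> M * (\<bar>a\<bar> * L\<^sup>2 + L) * \<delta>\<^sup>2" if t: "0 \<le> t" "t \<le> T" for t
    proof -
      have "\<bar>g t - f t\<bar> \<le> sqrt (t * exp ((2 * \<bar>a\<bar> + 1) * t)) * \<delta>"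
        unfolding \<delta>_def by (rule torus_solution_lipschitz[OF f g g0 t(1)])
      also have "\<dots> \<le> L * \<delta>"
        unfolding L_def using t T \<delta>(1) mult_left_mono[OF t(2), of "2 * \<bar>a\<bar> + 1"] by (intro mult_right_mono real_sqrt_le_mono mult_mono) auto
      finally have gf: "\<bar>g t - f t\<bar> \<le> L * \<delta>" .
      have gf2: "(g t - f t)\<^sup>2 \<le> (L * \<delta>)\<^sup>2" using gf by (metis abs_ge_zero power2_abs power_mono)
      have "\<bar>R t\<bar> = E t * \<bar>- a * (sin (g t) - sin (f t) - cos (f t) * (g t - f t)) - (a' - a) * (sin (g t) - sin (f t))\<bar>"
        using Epos[of t] by (simp add: R_def abs_mult)
      also have "\<dots> \<le> M * (\<bar>a\<bar> * (L * \<delta>)\<^sup>2 + \<delta> * (L * \<delta>))"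
      proof (rule mult_mono)
        have "\<bar>- a * (sin (g t) - sin (f t) - cos (f t) * (g t - f t)) - (a' - a) * (sin (g t) - sin (f t))\<bar>
          \<le> \<bar>a\<bar> * \<bar>sin (g t) - sin (f t) - cos (f t) * (g t - f t)\<bar> + \<bar>a' - a\<bar> * \<bar>sin (g t) - sin (f t)\<bar>"
          unfolding abs_mult[symmetric] by linarith
        also have "\<dots> \<le> \<bar>a\<bar> * (L * \<delta>)\<^sup>2 + \<delta> * (L * \<delta>)"
          using order_trans[OF sin_linearization gf2] order_trans[OF abs_sin_diff_le gf] \<delta>
          by (intro add_mono mult_mono) auto
        finally show "\<bar>- a * (sin (g t) - sin (f t) - cos (f t) * (g t - f t)) - (a' - a) * (sin (g t) - sin (f t))\<bar>
          \<le> \<bar>a\<bar> * (L * \<delta>)\<^sup>2 + \<delta> * (L * \<delta>)" .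
      qed (use M t M0 in auto)
      also have "\<dots> = M * (\<bar>a\<bar> * L\<^sup>2 + L) * \<delta>\<^sup>2" by (simp add: power2_eq_square algebra_simps)
      finally show ?thesis .
    qed
    have "norm (H T - H 0) \<le> M * (\<bar>a\<bar> * L\<^sup>2 + L) * \<delta>\<^sup>2 * norm (T - 0)"
      by (rule field_differentiable_bound[of "{0..T}" H R])
        (use H R T in \<open>auto intro: has_field_derivative_at_within\<close>)
    then show "\<bar>E T * (g T - f T) - J T\<bar> \<le> M * (\<bar>a\<bar> * L\<^sup>2 + L) * T * (\<bar>a' - a\<bar> + \<bar>b' - b\<bar> + \<bar>c' - c\<bar>)\<^sup>2"
      using T g0 J0 by (simp add: H_def \<delta>_def mult_ac)
  qed
qed

text \<open>\<open>a\<close> enters the field with the factor \<open>- sin f\<close>, so the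
  derivative of the flow in \<open>a\<close> is \<open>- S T / E T\<close>.\<close>

lemma flow_increases_as_a_decreases:
  assumes f: "torus_solution a b c f" and E: "variation_weight a f E" and T: "0 < T"
    and S0: "S 0 = 0" and S: "\<And>t. (S has_real_derivative E t * sin (f t)) (at t)" and pos: "S T > 0"
  shows "\<exists>e>0. \<forall>a'. a - e < a' \<and> a' < a \<longrightarrow> torus_flow a' b c (f 0) T > f T"
proof -
  obtain K where K: "0 \<le> K" "\<And>a' b' c' g J. torus_solution a' b' c' g \<Longrightarrow> g 0 = f 0 \<Longrightarrow> J 0 = 0 \<Longrightarrow>
     (\<And>t. (J has_real_derivative E t * (- (a' - a) * sin (f t) + (b' - b) + (c' - c) * cos t)) (at t)) \<Longrightarrow>
     \<bar>E T * (g T - f T) - J T\<bar> \<le> K * (\<bar>a' - a\<bar> + \<bar>b' - b\<bar> + \<bar>c' - c\<bar>)\<^sup>2"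
    using flow_first_order[OF f E T] by blast
  show ?thesis
  \<comment> \<open>Below this size of \<open>h\<close> the error \<open>K h\<^sup>2\<close> is
    smaller than the main term \<open>h S T\<close>; the summand 1 avoids a division by
    zero.\<close>
  proof (intro exI[of _ "S T / (K + 1)"] conjI allI impI)
    show "S T / (K + 1) > 0" using pos K(1) by simp
    fix a' assume a': "a - S T / (K + 1) < a' \<and> a' < a"
    define h where "h = a - a'"
    have h: "0 < h" "h < S T / (K + 1)" using a' by (auto simp: h_def)
    have "\<bar>E T * (torus_flow a' b c (f 0) T - f T) - h * S T\<bar> \<le> K * (\<bar>a' - a\<bar> + \<bar>b - b\<bar> + \<bar>c - c\<bar>)\<^sup>2"
      by (rule K(2)[OF torus_flow_solution])
        (auto simp: S0 h_def intro!: derivative_eq_intros S)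
    then have 1: "E T * (torus_flow a' b c (f 0) T - f T) \<ge> h * S T - K * h\<^sup>2"
      by (auto simp: h_def abs_minus_commute power2_commute)
    have "K * h \<le> (K + 1) * h" using h by simp
    also have "\<dots> < S T" using h(2) K(1) by (simp add: field_simps)
    finally have "h * (K * h) < h * S T" using h(1) by simp
    then have "E T * (torus_flow a' b c (f 0) T - f T) > 0"
      using 1 by (simp add: power2_eq_square mult_ac)
    moreover have "E T > 0" using E by (auto simp: variation_weight_def)
    ultimately show "torus_flow a' b c (f 0) T > f T" by (simp add: zero_less_mult_iff)
  qed
qed

text \<open>The derivative in \<open>b\<close> is the integral of \<open>E\<close> over
  \<open>E T\<close>, which is positive for every orbit.\<close>

lemma flow_decreases_as_b_decreases:
  assumes f: "torus_solution a b c f" and T: "0 < T"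
  shows "\<exists>e>0. \<forall>b'. b - e < b' \<and> b' < b \<longrightarrow> torus_flow a b' c (f 0) T < f T"
proof -
  obtain E where E: "variation_weight a f E"
    using variation_weight_exists[OF torus_solution_continuous_on[OF f]] by metis
  have Epos: "E t > 0" for t using E by (auto simp: variation_weight_def)
  obtain S where S0: "S 0 = 0" and S: "\<And>t. (S has_real_derivative E t) (at t)"
    using antiderivative_UNIV[OF variation_weight_continuous_on[OF E]] by metis
  have pos: "S T > 0"
    using DERIV_pos_imp_increasing[OF T, of S] S Epos S0 by force
  obtain K where K: "0 \<le> K" "\<And>a' b' c' g J. torus_solution a' b' c' g \<Longrightarrow> g 0 = f 0 \<Longrightarrow> J 0 = 0 \<Longrightarrow>
     (\<And>t. (J has_real_derivative E t * (- (a' - a) * sin (f t) + (b' - b) + (c' - c) * cos t)) (at t)) \<Longrightarrow>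
     \<bar>E T * (g T - f T) - J T\<bar> \<le> K * (\<bar>a' - a\<bar> + \<bar>b' - b\<bar> + \<bar>c' - c\<bar>)\<^sup>2"
    using flow_first_order[OF f E T] by blast
  show ?thesis
  proof (intro exI[of _ "S T / (K + 1)"] conjI allI impI)
    show "S T / (K + 1) > 0" using pos K(1) by simp
    fix b' assume b': "b - S T / (K + 1) < b' \<and> b' < b"
    define h where "h = b - b'"
    have h: "0 < h" "h < S T / (K + 1)" using b' by (auto simp: h_def)
    have "\<bar>E T * (torus_flow a b' c (f 0) T - f T) - (- h * S T)\<bar> \<le> K * (\<bar>a - a\<bar> + \<bar>b' - b\<bar> + \<bar>c - c\<bar>)\<^sup>2"
      by (rule K(2)[OF torus_flow_solution])
        (auto simp: S0 h_def algebra_simps intro!: derivative_eq_intros S)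
    then have 1: "E T * (torus_flow a b' c (f 0) T - f T) \<le> - h * S T + K * h\<^sup>2"
      by (auto simp: h_def abs_minus_commute power2_commute)
    have "K * h \<le> (K + 1) * h" using h by simp
    also have "\<dots> < S T" using h(2) K(1) by (simp add: field_simps)
    finally have "h * (K * h) < h * S T" using h(1) by simp
    then have "E T * (torus_flow a b' c (f 0) T - f T) < 0"
      using 1 by (simp add: power2_eq_square mult_ac)
    then show "torus_flow a b' c (f 0) T < f T" using Epos[of T] by (simp add: mult_less_0_iff)
  qed
qed

section \<open>Fourier modes on the circle\<close>

lemma continuous_bounded_Icc:
  fixes f :: "real \<Rightarrow> 'a::real_normed_vector"
  assumes "continuous_on {a..b} f"
  obtains M where "\<And>t. t \<in> {a..b} \<Longrightarrow> norm (f t) \<le> M"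
proof -
  have "bounded (f ` {a..b})" by (intro compact_imp_bounded compact_continuous_image assms compact_Icc)
  then show thesis using that unfolding bounded_iff by blast
qed

text \<open>Fourier coefficients without the factor 1 / (2 pi); the factor reappears wherever power
  series coefficients are compared with them.\<close>

definition circle_coeff :: "(real \<Rightarrow> complex) \<Rightarrow> int \<Rightarrow> complex" where
  "circle_coeff f n = integral {0..2 * pi} (\<lambda>t. f t * cis (- (of_int n * t)))"

lemma circle_coeff_add:
  assumes "continuous_on {0..2*pi} f" "continuous_on {0..2*pi} g"
  shows "circle_coeff (\<lambda>t. f t + g t) n = circle_coeff f n + circle_coeff g n"
  unfolding circle_coeff_def distrib_right
  by (intro Henstock_Kurzweil_Integration.integral_add integrable_continuous_real continuous_intros assms)

lemma circle_coeff_diff: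
  assumes "continuous_on {0..2*pi} f" "continuous_on {0..2*pi} g"
  shows "circle_coeff (\<lambda>t. f t - g t) n = circle_coeff f n - circle_coeff g n"
  unfolding circle_coeff_def left_diff_distrib
  by (intro Henstock_Kurzweil_Integration.integral_diff integrable_continuous_real continuous_intros assms)

lemma circle_coeff_cmult: "circle_coeff (\<lambda>t. c * f t) n = c * circle_coeff f n"
  unfolding circle_coeff_def mult.assoc by simp

lemma circle_coeff_shift: "circle_coeff (\<lambda>t. cis (of_int k * t) * f t) n = circle_coeff f (n - k)"
proof -
  have "cis (of_int k * t) * f t * cis (- (of_int n * t)) = f t * cis (- (of_int (n - k) * t))" for t
  proof -
    have "cis (of_int k * t) * f t * cis (- (of_int n * t)) = f t * (cis (of_int k * t) * cis (- (of_int n * t)))"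
      by (simp only: mult_ac)
    also have "\<dots> = f t * cis (- (of_int (n - k) * t))"
      by (simp add: cis_mult algebra_simps)
    finally show ?thesis .
  qed
  then show ?thesis by (simp only: circle_coeff_def)
qed

lemma circle_coeff_shift_1:
  "circle_coeff (\<lambda>t. cis t * f t) n = circle_coeff f (n - 1)"
  "circle_coeff (\<lambda>t. cis (- t) * f t) n = circle_coeff f (n + 1)"
  using circle_coeff_shift[of 1 f n] circle_coeff_shift[of "-1" f n] by simp_all

lemma circle_coeff_cnj: "circle_coeff (\<lambda>t. cnj (f t)) n = cnj (circle_coeff f (- n))"
  unfolding circle_coeff_def integral_cnj by (simp add: cis_cnj)

lemma circle_coeff_cong: "(\<And>t. 0 \<le> t \<Longrightarrow> t \<le> 2 * pi \<Longrightarrow> f t = g t) \<Longrightarrow> circle_coeff f n = circle_coeff g n"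
  unfolding circle_coeff_def by (rule Henstock_Kurzweil_Integration.integral_cong) auto

lemma cis_2pi_int: "cis (2 * pi * of_int k) = 1"
  using sin_cos_eq_iff[of "2 * pi * of_int k" 0] by (auto simp: complex_eq_iff)

lemma has_vector_derivative_cis:
  assumes "(g has_real_derivative g') (at t within S)"
  shows "((\<lambda>t. cis (g t)) has_vector_derivative \<i> * of_real g' * cis (g t)) (at t within S)"
proof -
  have "((\<lambda>t. \<i> * of_real (g t)) has_vector_derivative \<i> * of_real g') (at t within S)"
    using assms by (intro has_vector_derivative_mult_right has_vector_derivative_of_real)
  from field_vector_diff_chain_within[OF this, of exp "exp (\<i> * of_real (g t))"]
  show ?thesis by (simp add: cis_conv_exp o_def has_field_derivative_at_within)
qed

lemma circle_coeff_deriv: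
  assumes f: "\<And>t. (f has_vector_derivative f' t) (at t)"
    and cont: "continuous_on UNIV f'" and per: "f (2 * pi) = f 0"
  shows "circle_coeff f' n = \<i> * of_int n * circle_coeff f n"
proof -
  let ?e = "\<lambda>t. cis (- (of_int n * t))"
  have contf: "continuous_on UNIV f"
    using f by (meson continuous_at_imp_continuous_on has_vector_derivative_continuous)
  have D: "((\<lambda>t. f t * ?e t) has_vector_derivative f' t * ?e t - \<i> * of_int n * (f t * ?e t)) (at t within S)" for t S
  proof -
    have "((\<lambda>t. - (of_int n * t)) has_real_derivative - of_int n) (at t within S)"
      by (auto intro!: derivative_eq_intros)
    from has_vector_derivative_mult[OF has_vector_derivative_at_within[OF f] has_vector_derivative_cis[OF this]]
    show ?thesis by (simp add: algebra_simps)
  qed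
  have "((\<lambda>t. f' t * ?e t - \<i> * of_int n * (f t * ?e t)) has_integral f (2*pi) * ?e (2*pi) - f 0 * ?e 0) {0..2*pi}"
    by (rule fundamental_theorem_of_calculus) (use D in auto)
  moreover have "?e (2 * pi) = 1" using cis_2pi_int[of "- n"] by (simp add: mult.commute)
  ultimately have "integral {0..2*pi} (\<lambda>t. f' t * ?e t - \<i> * of_int n * (f t * ?e t)) = 0"
    using per by (simp add: integral_unique)
  moreover have "integral {0..2*pi} (\<lambda>t. f' t * ?e t - \<i> * of_int n * (f t * ?e t))
      = circle_coeff f' n - integral {0..2*pi} (\<lambda>t. \<i> * of_int n * (f t * ?e t))"
    unfolding circle_coeff_def
    by (intro Henstock_Kurzweil_Integration.integral_diff integrable_continuous_real continuous_intros
        continuous_on_subset[OF cont] continuous_on_subset[OF contf]) auto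
  ultimately show ?thesis by (simp add: circle_coeff_def)
qed

section \<open>Completeness of the modes for continuous periodic functions\<close>

lemma periodic_add_int:
  fixes d :: "real \<Rightarrow> 'a"
  assumes "\<And>t. d (t + 2 * pi) = d t"
  shows "d (t + 2 * pi * of_int k) = d t"
proof (induction k rule: int_induct[of _ 0])
  case base
  then show ?case by simp
next
  case (step1 i)
  have "d (t + 2 * pi * of_int (i + 1)) = d ((t + 2 * pi * of_int i) + 2 * pi)" by (simp add: algebra_simps)
  then show ?case using assms step1 by simp
next
  case (step2 i)
  have "d (t + 2 * pi * of_int i) = d ((t + 2 * pi * of_int (i - 1)) + 2 * pi)" by (simp add: algebra_simps)
  then show ?case using assms step2 by simp
qed

lemma periodic_Arg:
  assumes per: "\<And>t. d (t + 2 * pi) = d t"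
  shows "d (Arg (cis t)) = d t"
proof -
  have "cis (Arg (cis t)) = cis t" using cis_Arg[of "cis t"] by (simp add: sgn_div_norm)
  then have "sin (Arg (cis t)) = sin t \<and> cos (Arg (cis t)) = cos t" by (simp add: complex_eq_iff)
  then obtain n :: int where "Arg (cis t) = t + 2 * pi * n" using sin_cos_eq_iff by blast
  then show ?thesis using periodic_add_int[of d t n, OF per] by simp
qed

text \<open>This carries periodic functions to the circle, where Stone-Weierstrass applies.
  \<open>Arg\<close> jumps by a full turn on the negative real axis; near that axis
  \<open>Arg (- w) + pi\<close> is a continuous substitute, equal to it up to a period.\<close>

lemma continuous_on_periodic_Arg:
  fixes d :: "real \<Rightarrow> 'a::topological_space"
  assumes cont: "continuous_on UNIV d" and per: "\<And>t. d (t + 2 * pi) = d t"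
  shows "continuous_on (sphere 0 1) (\<lambda>z. d (Arg z))"
proof (rule continuous_at_imp_continuous_on, rule ballI)
  fix z :: complex assume "z \<in> sphere 0 1"
  then have z: "z \<noteq> 0" by auto
  have dcont: "isCont d x" for x using cont by (simp add: continuous_on_eq_continuous_at)
  show "isCont (\<lambda>z. d (Arg z)) z"
  proof (cases "z \<in> \<real>\<^sub>\<le>\<^sub>0")
    case False
    then show ?thesis using isCont_o2[OF continuous_at_Arg dcont] by blast
  next
    case True
    then have "- z \<notin> \<real>\<^sub>\<le>\<^sub>0" using z by (auto simp: complex_nonpos_Reals_iff complex_eq_iff)
    then have "isCont (\<lambda>w. Arg (- w)) z"
      using isCont_o2[OF _ continuous_at_Arg, of z uminus] by simp
    then have "isCont (\<lambda>w. d (Arg (- w) + pi)) z"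
      by (intro isCont_o2[OF _ dcont] continuous_intros)
    moreover have "\<forall>\<^sub>F w in nhds z. d (Arg w) = d (Arg (- w) + pi)"
    proof -
      have "\<forall>\<^sub>F w in nhds z. w \<noteq> 0" using z by (simp add: t1_space_nhds)
      then show ?thesis
      proof eventually_elim
        case (elim w)
        have "d (Arg w + 2 * pi) = d (Arg w)" by (rule per)
        then show ?case using Arg_minus[OF elim] by (auto simp: algebra_simps)
      qed
    qed
    ultimately show ?thesis using isCont_cong by fast
  qed
qed

text \<open>Multiplication by a real-linear function of \<open>cis t\<close> only mixes neighbouring
  modes, so a function without modes stays without modes. \<open>d\<close> is kept general because a
  product applies the claim to an already multiplied function.\<close>

lemma circle_coeff_zero_real_polynomial:
  fixes g :: "complex \<Rightarrow> real"
  assumes "real_polynomial_function g" "continuous_on UNIV d" "\<And>n. circle_coeff d n = 0"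
  shows "continuous_on UNIV (\<lambda>t. of_real (g (cis t)) * d t) \<and>
    (\<forall>n. circle_coeff (\<lambda>t. of_real (g (cis t)) * d t) n = 0)"
  using assms
proof (induction arbitrary: d rule: real_polynomial_function.induct)
  case (linear g)
  interpret g: bounded_linear g by fact
  \<comment> \<open>Chosen so that \<open>g (cis t)\<close> is \<open>\<alpha> cis t\<close> plus
    its conjugate.\<close>
  define \<alpha> where "\<alpha> = Complex (g 1 / 2) (- g \<i> / 2)"
  have eq: "of_real (g (cis t)) * d t = \<alpha> * (cis t * d t) + cnj \<alpha> * (cis (- t) * d t)" for t
  proof -
    have "cis t = cos t *\<^sub>R 1 + sin t *\<^sub>R \<i>" by (simp add: complex_eq_iff)
    then have "g (cis t) = cos t * g 1 + sin t * g \<i>"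
      by (metis g.add g.scaleR real_scaleR_def)
    then have "of_real (g (cis t)) = \<alpha> * cis t + cnj \<alpha> * cis (- t)"
      by (simp add: \<alpha>_def complex_eq_iff)
    then show ?thesis by (simp add: algebra_simps)
  qed
  have c: "continuous_on S (\<lambda>t. \<alpha> * (cis t * d t))" "continuous_on S (\<lambda>t. cnj \<alpha> * (cis (- t) * d t))" for S
    by (intro continuous_intros continuous_on_subset[OF linear(2)]; simp)+
  show ?case
    unfolding eq using c
    by (auto intro!: continuous_on_add simp: circle_coeff_add circle_coeff_cmult circle_coeff_shift_1 linear(3))
next
  case (const c)
  then show ?case by (auto intro!: continuous_intros simp: circle_coeff_cmult)
next
  case (add f g)
  have c: "continuous_on S (\<lambda>t. of_real (f (cis t)) * d t)" "continuous_on S (\<lambda>t. of_real (g (cis t)) * d t)" for S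
    using add.IH(1)[OF add.prems] add.IH(2)[OF add.prems] by (meson continuous_on_subset subset_UNIV)+
  show ?case
    using add.IH(1)[OF add.prems] add.IH(2)[OF add.prems] c
    by (auto simp: distrib_right circle_coeff_add intro!: continuous_on_add)
next
  case (mult f g)
  have "continuous_on UNIV (\<lambda>t. of_real (g (cis t)) * d t)" "\<And>n. circle_coeff (\<lambda>t. of_real (g (cis t)) * d t) n = 0"
    using mult.IH(2)[OF mult.prems] by blast+
  from mult.IH(1)[OF this] show ?case by (simp add: mult.assoc)
qed

text \<open>On the circle \<open>u\<close> is a uniform limit of real polynomials, and the previous
  lemma settles those.\<close>

lemma circle_coeff_zero_imp_orthogonal:
  fixes u :: "real \<Rightarrow> real"
  assumes cont: "continuous_on UNIV d" and zero: "\<And>n. circle_coeff d n = 0"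
    and u: "continuous_on UNIV u" and uper: "\<And>t. u (t + 2 * pi) = u t"
  shows "integral {0..2*pi} (\<lambda>t. of_real (u t) * d t) = 0"
proof -
  have cont': "continuous_on {0..2*pi} d" "continuous_on {0..2*pi} u"
    using cont u by (meson continuous_on_subset subset_UNIV)+
  obtain M where M: "\<And>t. t \<in> {0..2*pi} \<Longrightarrow> norm (d t) \<le> M"
    using continuous_bounded_Icc[OF cont'(1)] by blast
  have M0: "M \<ge> 0" using order_trans[OF norm_ge_zero M[of 0]] by simp
  have "norm (integral {0..2*pi} (\<lambda>t. of_real (u t) * d t)) \<le> 0 + e" if e: "e > 0" for e
  proof -
    define \<epsilon> where "\<epsilon> = e / (2 * pi * (M + 1))"
    have \<epsilon>: "\<epsilon> > 0" using e M0 by (simp add: \<epsilon>_def)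
    obtain g where g: "real_polynomial_function g" "\<And>z. z \<in> sphere 0 1 \<Longrightarrow> \<bar>u (Arg z) - g z\<bar> < \<epsilon>"
      using Stone_Weierstrass_real_polynomial_function[OF _ continuous_on_periodic_Arg[OF u uper] \<epsilon>]
      by auto
    have gz: "continuous_on UNIV (\<lambda>t. of_real (g (cis t)) * d t)"
      "circle_coeff (\<lambda>t. of_real (g (cis t)) * d t) 0 = 0"
      using circle_coeff_zero_real_polynomial[OF g(1) cont zero] by blast+
    have close: "\<bar>u t - g (cis t)\<bar> \<le> \<epsilon>" for t
      using g(2)[of "cis t"] periodic_Arg[of u t, OF uper] by simp
    have gz': "continuous_on {0..2*pi} (\<lambda>t. of_real (g (cis t)) * d t)"
      using gz(1) by (meson continuous_on_subset subset_UNIV)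
    have "integral {0..2*pi} (\<lambda>t. of_real (u t) * d t)
        = integral {0..2*pi} (\<lambda>t. of_real (u t) * d t - of_real (g (cis t)) * d t)"
      using gz(2) gz' cont'
      by (subst Henstock_Kurzweil_Integration.integral_diff)
        (auto intro!: integrable_continuous_real continuous_intros simp: circle_coeff_def)
    also have "norm \<dots> \<le> (\<epsilon> * M) * (2 * pi - 0)"
    proof (rule integral_bound)
      show "norm (of_real (u t) * d t - of_real (g (cis t)) * d t) \<le> \<epsilon> * M" if "t \<in> {0..2*pi}" for t
        using M[OF that] close[of t] \<epsilon>
        by (auto simp: norm_mult left_diff_distrib[symmetric] of_real_diff[symmetric] simp del: of_real_diff intro!: mult_mono)
    qed (auto intro!: continuous_intros cont' gz')
    also have "\<dots> \<le> e"
    proof -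
      have "\<epsilon> * M * (2 * pi) \<le> \<epsilon> * (M + 1) * (2 * pi)" using \<epsilon> by (intro mult_right_mono mult_left_mono) auto
      also have "\<dots> = e" using M0 by (simp add: \<epsilon>_def field_simps add_nonneg_eq_0_iff)
      finally show ?thesis by simp
    qed
    finally show ?thesis by simp
  qed
  then have "norm (integral {0..2*pi} (\<lambda>t. of_real (u t) * d t)) \<le> 0" by (rule field_le_epsilon)
  then show ?thesis by simp
qed

text \<open>Testing \<open>d\<close> against its own real and imaginary part yields the integral of
  its squared modulus.\<close>

lemma circle_coeff_unique:
  assumes cont: "continuous_on UNIV d" and per: "\<And>t. d (t + 2 * pi) = d t"
    and zero: "\<And>n. circle_coeff d n = 0"
  shows "d t = 0"
proof -
  have "(\<lambda>t. of_real ((cmod (d t))\<^sup>2)) = (\<lambda>t. of_real (Re (d t)) * d t - \<i> * (of_real (Im (d t)) * d t))"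
    by (rule ext) (simp add: complex_eq_iff cmod_power2 del: of_real_power, simp add: power2_eq_square)
  moreover have "integral {0..2*pi} (\<lambda>t. of_real (Re (d t)) * d t - \<i> * (of_real (Im (d t)) * d t)) = 0"
  proof -
    have c: "continuous_on {0..2*pi} d" using cont by (meson continuous_on_subset subset_UNIV)
    have "integral {0..2*pi} (\<lambda>t. of_real (Re (d t)) * d t) = 0"
      "integral {0..2*pi} (\<lambda>t. of_real (Im (d t)) * d t) = 0"
      by (rule circle_coeff_zero_imp_orthogonal[OF cont zero]; auto intro!: continuous_intros cont simp: per)+
    then show ?thesis
      using c by (subst Henstock_Kurzweil_Integration.integral_diff)
        (auto intro!: integrable_continuous_real continuous_intros)
  qed
  ultimately have "integral {0..2*pi} (\<lambda>t. complex_of_real ((cmod (d t))\<^sup>2)) = 0" by simp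
  moreover have c: "continuous_on {0..2*pi} (\<lambda>t. (cmod (d t))\<^sup>2)"
    by (intro continuous_intros continuous_on_subset[OF cont]) auto
  have "((\<lambda>t. complex_of_real ((cmod (d t))\<^sup>2)) has_integral
      complex_of_real (integral {0..2*pi} (\<lambda>t. (cmod (d t))\<^sup>2))) {0..2*pi}"
    using has_integral_linear[OF integrable_integral[OF integrable_continuous_real[OF c]] bounded_linear_of_real]
    by (simp add: o_def)
  ultimately have "integral {0..2*pi} (\<lambda>t. (cmod (d t))\<^sup>2) = 0"
    by (metis integral_unique of_real_eq_0_iff)
  then have z: "d s = 0" if "s \<in> {0..2*pi}" for s
    using integral_eq_0_iff[OF c] that by auto
  obtain k :: int where "of_int k * (2 * pi) \<le> t" "t < (of_int k + 1) * (2 * pi)"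
    using floor_divide_lower[of "2 * pi" t] floor_divide_upper[of "2 * pi" t] pi_gt_zero by auto
  then have "d (t - 2 * pi * of_int k) = 0"
    by (intro z) (auto simp: algebra_simps)
  moreover have "d (t - 2 * pi * of_int k) = d t"
    using periodic_add_int[of d "t - 2 * pi * of_int k" k, OF per] by simp
  ultimately show ?thesis by simp
qed

lemma norm_circle_coeff_le:
  assumes cont: "continuous_on UNIV f" 
  obtains M where "\<And>n. norm (circle_coeff f n) \<le> M"
proof -
  have cont': "continuous_on {0..2*pi} f" using cont by (meson continuous_on_subset subset_UNIV)
  obtain M where M: "\<And>t. t \<in> {0..2*pi} \<Longrightarrow> norm (f t) \<le> M"
    using continuous_bounded_Icc[OF cont'] by blast
  have "norm (circle_coeff f n) \<le> M * (2 * pi - 0)" for n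
    unfolding circle_coeff_def
    by (rule integral_bound) (use M in \<open>auto simp: norm_mult intro!: continuous_intros cont'\<close>)
  then show thesis by (rule that)
qed

section \<open>Power series on a disc larger than the unit disc\<close>

lemma integral_circle_holomorphic:
  assumes "F holomorphic_on ball 0 r" "r > 1"
  shows "integral {0..2*pi} (\<lambda>t. cis t * F (cis t)) = 0"
proof -
  obtain G where G: "\<And>z. z \<in> ball 0 r \<Longrightarrow> (G has_field_derivative F z) (at z within ball 0 r)"
    using holomorphic_convex_primitive'[OF convex_ball open_ball assms(1)] by blast
  have D: "((\<lambda>t. G (cis t)) has_vector_derivative \<i> * (cis t * F (cis t))) (at t within S)" for t S
  proof -
    have "(G has_field_derivative F (cis t)) (at (cis t))"
      using G[of "cis t"] assms(2) by (simp add: at_within_open[OF _ open_ball])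
    moreover have "((\<lambda>t. cis t) has_vector_derivative \<i> * cis t) (at t within S)"
      using has_vector_derivative_cis[OF DERIV_ident] by simp
    ultimately show ?thesis
      using field_vector_diff_chain_within[of cis "\<i> * cis t" t S G "F (cis t)"]
      by (simp add: o_def mult_ac has_field_derivative_at_within)
  qed
  have "((\<lambda>t. \<i> * (cis t * F (cis t))) has_integral G (cis (2*pi)) - G (cis 0)) {0..2*pi}"
    by (rule fundamental_theorem_of_calculus) (use D in auto)
  from integral_unique[OF this] show ?thesis by simp
qed

lemma circle_coeff_holomorphic:
  assumes "F holomorphic_on ball 0 r" "r > 1" "n < 0"
  shows "circle_coeff (\<lambda>t. F (cis t)) n = 0"
proof -
  \<comment> \<open>Of the \<open>- n\<close> factors \<open>cis t\<close>, one belongs to the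
    contour element \<open>dz\<close>; the other \<open>m\<close> stay in the holomorphic
    integrand.\<close>
  define m where "m = nat (- n - 1)"
  have m: "- of_int n = 1 + real m" using assms(3) by (simp add: m_def)
  have "cis (- (of_int n * t)) = cis t * cis t ^ m" for t
  proof -
    have "- (of_int n * t) = (- of_int n) * t" by simp
    also have "\<dots> = t + real m * t" unfolding m by (simp add: algebra_simps)
    finally show ?thesis by (simp add: Complex.DeMoivre cis_mult)
  qed
  then have "circle_coeff (\<lambda>t. F (cis t)) n = integral {0..2*pi} (\<lambda>t. cis t * (cis t ^ m * F (cis t)))"
    by (simp add: circle_coeff_def mult_ac)
  also have "\<dots> = 0"
    by (rule integral_circle_holomorphic[of "\<lambda>z. z ^ m * F z" r]) (use assms in \<open>auto intro!: holomorphic_intros\<close>)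
  finally show ?thesis .
qed

definition power_sum :: "(nat \<Rightarrow> complex) \<Rightarrow> complex \<Rightarrow> complex" where
  "power_sum a z = (\<Sum>n. a n * z ^ n)"

text \<open>The decay rate 1/2 gives convergence up to radius 2, so the unit circle lies well
  inside.\<close>

lemma power_sum_sums:
  assumes a: "\<And>n. norm (a n) \<le> C * (1/2) ^ n" and z: "z \<in> ball 0 2"
  shows "(\<lambda>n. a n * z ^ n) sums power_sum a z"
proof -
  have "summable (\<lambda>n. C * (norm z / 2) ^ n)"
    using z by (intro summable_mult summable_geometric) auto
  moreover have "norm (a n * z ^ n) \<le> C * (norm z / 2) ^ n" for n
  proof -
    have "norm (a n * z ^ n) \<le> C * (1/2) ^ n * norm z ^ n"
      unfolding norm_mult norm_power by (intro mult_right_mono a) auto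
    then show ?thesis by (simp add: power_divide)
  qed
  ultimately have "summable (\<lambda>n. a n * z ^ n)" by (rule summable_comparison_test'[where N = 0])
  then show ?thesis by (simp add: power_sum_def summable_sums)
qed

lemma power_sum_holomorphic:
  assumes a: "\<And>n. norm (a n) \<le> C * (1/2) ^ n"
  shows "power_sum a holomorphic_on ball 0 2"
  using power_series_holomorphic[of 0 2 a "power_sum a"] power_sum_sums[OF a] by simp

text \<open>The series converges uniformly on the circle. The second factor \<open>h\<close> is
  arbitrary so that the same statement yields both the Fourier coefficients and the area
  formula.\<close>

lemma integral_power_sum_sums:
  assumes a: "\<And>n. norm (a n) \<le> C * (1/2) ^ n" and h: "continuous_on {0..2*pi} h"
  shows "(\<lambda>n. a n * integral {0..2*pi} (\<lambda>t. cis (real n * t) * h t))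
    sums integral {0..2*pi} (\<lambda>t. power_sum a (cis t) * h t)"
proof -
  obtain M where M: "\<And>t. t \<in> {0..2*pi} \<Longrightarrow> norm (h t) \<le> M"
    using continuous_bounded_Icc[OF h] by blast
  have M0: "M \<ge> 0" using order_trans[OF norm_ge_zero M[of 0]] by simp
  have C0: "C \<ge> 0" using order_trans[OF norm_ge_zero a[of 0]] by simp
  let ?f = "\<lambda>n t. a n * cis (real n * t) * h t"
  have lim: "uniform_limit {0..2*pi} (\<lambda>n t. \<Sum>i<n. ?f i t) (\<lambda>t. \<Sum>i. ?f i t) sequentially"
  proof (rule Weierstrass_m_test)
    show "norm (?f n t) \<le> C * (1/2) ^ n * M" if "t \<in> {0..2*pi}" for n t
      unfolding norm_mult using a M[OF that] M0 C0 by (auto intro!: mult_mono)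
    show "summable (\<lambda>n. C * (1/2) ^ n * M)"
      by (intro summable_mult2 summable_mult summable_geometric) auto
  qed
  have sumf: "(\<Sum>i. ?f i t) = power_sum a (cis t) * h t" for t
  proof -
    have "(\<lambda>n. a n * cis t ^ n * h t) sums (power_sum a (cis t) * h t)"
      by (intro sums_mult2 power_sum_sums[OF a]) auto
    then show ?thesis by (simp add: Complex.DeMoivre sums_iff)
  qed
  obtain I J where I: "\<And>n. ((\<lambda>t. \<Sum>i<n. ?f i t) has_integral I n) {0..2*pi}"
    and J: "((\<lambda>t. \<Sum>i. ?f i t) has_integral J) {0..2*pi}" and IJ: "I \<longlonglongrightarrow> J"
    by (rule uniform_limit_integral[OF lim]) (auto intro!: continuous_intros h)
  have In: "I n = (\<Sum>i<n. a i * integral {0..2*pi} (\<lambda>t. cis (real i * t) * h t))" for n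
  proof -
    have "I n = integral {0..2*pi} (\<lambda>t. \<Sum>i<n. ?f i t)" by (rule integral_unique[OF I, symmetric])
    also have "\<dots> = (\<Sum>i<n. integral {0..2*pi} (?f i))"
      by (intro Henstock_Kurzweil_Integration.integral_sum integrable_continuous_real continuous_intros h) auto
    finally show ?thesis by (simp add: mult.assoc)
  qed
  show ?thesis
    using IJ integral_unique[OF J] unfolding In[abs_def] sums_def by (simp add: sumf)
qed

lemma integral_cis_int: "integral {0..2*pi} (\<lambda>t. cis (of_int k * t)) = (if k = 0 then of_real (2 * pi) else 0)"
proof (cases "k = 0")
  case True
  have "((\<lambda>t::real. 1::complex) has_integral (2 * pi - 0) *\<^sub>R 1) {0..2*pi}"
    using has_integral_const_real[of "1::complex" 0 "2 * pi"] by simp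
  then show ?thesis using True by (simp add: integral_unique scaleR_conv_of_real)
next
  case False
  have D: "((\<lambda>t. cis (of_int k * t)) has_vector_derivative \<i> * of_int k * cis (of_int k * t)) (at t within S)" for t S
  proof -
    have "((\<lambda>t. of_int k * t) has_real_derivative of_int k) (at t within S)"
      by (auto intro!: derivative_eq_intros)
    from has_vector_derivative_cis[OF this] show ?thesis by simp
  qed
  have "((\<lambda>t. \<i> * of_int k * cis (of_int k * t)) has_integral cis (of_int k * (2*pi)) - cis (of_int k * 0)) {0..2*pi}"
    by (rule fundamental_theorem_of_calculus) (use D in auto)
  from integral_unique[OF this] show ?thesis
    using False cis_2pi_int[of k] by (simp add: mult.commute[of "real_of_int k" "2 * pi"])
qed

lemma circle_coeff_power_sum:
  fixes a :: "nat \<Rightarrow> complex"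
  assumes a: "\<And>n. norm (a n) \<le> C * (1/2) ^ n"
  shows "circle_coeff (\<lambda>t. power_sum a (cis t)) m = (if 0 \<le> m then of_real (2 * pi) * a (nat m) else 0)"
proof -
  have "(\<lambda>n. a n * integral {0..2*pi} (\<lambda>t. cis (real n * t) * cis (- (of_int m * t))))
    sums circle_coeff (\<lambda>t. power_sum a (cis t)) m"
    unfolding circle_coeff_def by (rule integral_power_sum_sums[OF a]) (intro continuous_intros)
  also have "(\<lambda>n. a n * integral {0..2*pi} (\<lambda>t. cis (real n * t) * cis (- (of_int m * t))))
     = (\<lambda>n. if int n = m then of_real (2 * pi) * a n else 0)"
  proof
    fix n
    have "cis (real n * t) * cis (- (of_int m * t)) = cis (of_int (int n - m) * t)" for t
      by (simp add: cis_mult algebra_simps)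
    then show "a n * integral {0..2*pi} (\<lambda>t. cis (real n * t) * cis (- (of_int m * t)))
       = (if int n = m then of_real (2 * pi) * a n else 0)"
      using integral_cis_int[of "int n - m"] by auto
  qed
  finally have s: "(\<lambda>n. if int n = m then of_real (2 * pi) * a n else 0) sums circle_coeff (\<lambda>t. power_sum a (cis t)) m" .
  show ?thesis
  proof (cases "0 \<le> m")
    case True
    then obtain k where k: "m = int k" by (rule nonneg_int_cases)
    have "(\<lambda>n. if int n = m then of_real (2 * pi) * a n else 0) sums (of_real (2 * pi) * a k)"
      using sums_single[of k "\<lambda>n. of_real (2 * pi) * a n"] by (simp add: k)
    from sums_unique2[OF s this] show ?thesis by (simp add: k)
  next
    case False
    then have "(\<lambda>n. if int n = m then of_real (2 * pi) * a n else 0) = (\<lambda>n. 0)" by auto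
    with s have "(\<lambda>n. 0) sums circle_coeff (\<lambda>t. power_sum a (cis t)) m" by simp
    from sums_unique2[OF this sums_zero] False show ?thesis by simp
  qed
qed

text \<open>A Parseval identity for \<open>w\<close> and \<open>w'\<close>. Only \<open>w\<close> is
  expanded, and the integral is conjugated first; \<open>w'\<close> then enters through its
  coefficients, so no series for it is required.\<close>

lemma area_sums:
  fixes a :: "nat \<Rightarrow> complex"
  assumes a: "\<And>n. norm (a n) \<le> C * (1/2) ^ n"
    and w: "\<And>t. (w has_vector_derivative w' t) (at t)" and cont: "continuous_on UNIV w'"
    and per: "w (2 * pi) = w 0" and eq: "\<And>t. w t = power_sum a (cis t)"
  shows "(\<lambda>n. 2 * pi * \<i> * of_nat n * of_real ((cmod (a n))\<^sup>2)) sums integral {0..2*pi} (\<lambda>t. cnj (w t) * w' t)"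
proof -
  have "(\<lambda>n. a n * integral {0..2*pi} (\<lambda>t. cis (real n * t) * cnj (w' t)))
    sums integral {0..2*pi} (\<lambda>t. power_sum a (cis t) * cnj (w' t))"
    by (intro integral_power_sum_sums[OF a] continuous_intros continuous_on_subset[OF cont]) auto
  then have "(\<lambda>n. cnj (a n * integral {0..2*pi} (\<lambda>t. cis (real n * t) * cnj (w' t))))
    sums cnj (integral {0..2*pi} (\<lambda>t. power_sum a (cis t) * cnj (w' t)))"
    by (simp only: sums_cnj)
  also have "(\<lambda>n. cnj (a n * integral {0..2*pi} (\<lambda>t. cis (real n * t) * cnj (w' t))))
     = (\<lambda>n. cnj (a n) * circle_coeff w' (int n))"
    unfolding complex_cnj_mult integral_cnj by (simp add: circle_coeff_def cis_cnj mult.commute)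
  also have "\<dots> = (\<lambda>n. 2 * pi * \<i> * of_nat n * of_real ((cmod (a n))\<^sup>2))"
  proof
    fix n
    have "circle_coeff w (int n) = 2 * pi * a n"
      unfolding eq by (simp add: circle_coeff_power_sum[OF a])
    then have "circle_coeff w' (int n) = \<i> * of_nat n * (2 * pi * a n)"
      using circle_coeff_deriv[OF w cont per, of "int n"] by simp
    then show "cnj (a n) * circle_coeff w' (int n) = 2 * pi * \<i> * of_nat n * of_real ((cmod (a n))\<^sup>2)"
      by (simp add: complex_norm_square mult_ac del: of_real_power)
  qed
  also have "cnj (integral {0..2*pi} (\<lambda>t. power_sum a (cis t) * cnj (w' t))) = integral {0..2*pi} (\<lambda>t. cnj (w t) * w' t)"
    by (simp add: integral_cnj eq)
  finally show ?thesis .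
qed

text \<open>A bound valid from \<open>N + j\<close> on is halved from \<open>N + j + 1\<close> on,
  because both neighbours of such an index still obey the old bound.\<close>

lemma geometric_decay:
  fixes x :: "nat \<Rightarrow> real"
  assumes bound: "\<And>n. 0 \<le> x n \<and> x n \<le> K"
    and rec: "\<And>n. n \<ge> N \<Longrightarrow> x (Suc n) \<le> (x n + x (Suc (Suc n))) / 4"
  obtains C where "0 \<le> C" "\<And>n. x n \<le> C * (1/2) ^ n"
proof -
  have K0: "K \<ge> 0" using bound[of 0] by auto
  have dec: "x n \<le> K * (1/2) ^ j" if "n \<ge> N + j" for n j
    using that
  proof (induction j arbitrary: n)
    case (Suc j)
    then obtain m where m: "n = Suc m" by (cases n) auto
    have "x n \<le> (x m + x (Suc (Suc m))) / 4" using rec[of m] Suc.prems m by auto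
    also have "\<dots> \<le> (K * (1/2) ^ j + K * (1/2) ^ j) / 4"
      using Suc.IH[of m] Suc.IH[of "Suc (Suc m)"] Suc.prems m by simp
    finally show ?case by simp
  qed (use bound in auto)
  show thesis
  proof (rule that[of "K * 2 ^ N"])
    fix n
    show "x n \<le> K * 2 ^ N * (1/2) ^ n"
    proof (cases "n \<ge> N")
      case True
      then have "x n \<le> K * (1/2) ^ (n - N)" by (intro dec) auto
      also have "\<dots> = K * 2 ^ N * (1/2) ^ n" using True by (simp add: power_diff field_simps)
      finally show ?thesis .
    next
      case False
      have "K * 1 \<le> K * (2 ^ N * (1/2) ^ n)"
      proof (rule mult_left_mono[OF _ K0])
        have "(2::real) ^ n \<le> 2 ^ N" using False by (intro power_increasing) auto
        then show "(1::real) \<le> 2 ^ N * (1/2) ^ n" by (simp add: power_divide field_simps)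
      qed
      then show ?thesis using bound[of n] by simp
    qed
  qed (use K0 in auto)
qed

section \<open>The double confluent Heun equation\<close>

text \<open>The equation in the angular variable \<open>t\<close>. Carrying \<open>u'\<close> along
  makes the pair the state of a first-order system, so that initial data at 0 can be compared
  directly.\<close>

definition heun_solution :: "nat \<Rightarrow> real \<Rightarrow> real \<Rightarrow> (real \<Rightarrow> complex) \<Rightarrow> (real \<Rightarrow> complex) \<Rightarrow> bool" where
  "heun_solution l \<mu> \<kappa> u u' \<longleftrightarrow> (\<forall>t. (u has_vector_derivative u' t) (at t) \<and>
     (u' has_vector_derivative \<i> * of_real (real l + 2 * \<mu> * cos t) * u' t + of_real (\<kappa>\<^sup>2) * u t) (at t))"

lemma heun_solutionD:
  assumes "heun_solution l \<mu> \<kappa> u u'"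
  shows "(u has_vector_derivative u' t) (at t)"
    and "(u' has_vector_derivative \<i> * of_real (real l + 2 * \<mu> * cos t) * u' t + of_real (\<kappa>\<^sup>2) * u t) (at t)"
  using assms by (simp_all add: heun_solution_def)

lemma has_vector_derivative_continuous_on:
  "(\<And>t. (u has_vector_derivative u' t) (at t)) \<Longrightarrow> continuous_on S u"
  by (meson continuous_at_imp_continuous_on has_vector_derivative_continuous)

lemma heun_solution_continuous_on:
  assumes "heun_solution l \<mu> \<kappa> u u'"
  shows "continuous_on S u" "continuous_on S u'"
  by (rule has_vector_derivative_continuous_on heun_solutionD[OF assms])+

lemma heun_solution_lincomb:
  assumes u: "heun_solution l \<mu> \<kappa> u u'" and v: "heun_solution l \<mu> \<kappa> v v'"
  shows "heun_solution l \<mu> \<kappa> (\<lambda>t. \<alpha> * u t + \<beta> * v t) (\<lambda>t. \<alpha> * u' t + \<beta> * v' t)"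
  unfolding heun_solution_def
proof (intro allI conjI)
  fix t
  show "((\<lambda>t. \<alpha> * u t + \<beta> * v t) has_vector_derivative \<alpha> * u' t + \<beta> * v' t) (at t)"
    by (intro has_vector_derivative_add has_vector_derivative_mult_right heun_solutionD(1)[OF u] heun_solutionD(1)[OF v])
  have "((\<lambda>t. \<alpha> * u' t + \<beta> * v' t) has_vector_derivative
      \<alpha> * (\<i> * of_real (real l + 2 * \<mu> * cos t) * u' t + of_real (\<kappa>\<^sup>2) * u t)
      + \<beta> * (\<i> * of_real (real l + 2 * \<mu> * cos t) * v' t + of_real (\<kappa>\<^sup>2) * v t)) (at t)"
    by (intro has_vector_derivative_add has_vector_derivative_mult_right heun_solutionD(2)[OF u] heun_solutionD(2)[OF v])
  then show "((\<lambda>t. \<alpha> * u' t + \<beta> * v' t) has_vector_derivative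
      \<i> * of_real (real l + 2 * \<mu> * cos t) * (\<alpha> * u' t + \<beta> * v' t) + of_real (\<kappa>\<^sup>2) * (\<alpha> * u t + \<beta> * v t)) (at t)"
    by (simp add: algebra_simps)
qed

text \<open>The coefficient of \<open>u'\<close> is imaginary and drops out of the derivative of the
  squared modulus of \<open>u'\<close>; what is left of the energy estimate is independent of \<mu>
  and \<open>l\<close>.\<close>

lemma heun_solution_zero:
  assumes u: "heun_solution l \<mu> \<kappa> u u'" and 0: "u 0 = 0" "u' 0 = 0" and T: "0 \<le> T"
  shows "u T = 0 \<and> u' T = 0"
proof -
  define e where "e t = inner (u t) (u t) + inner (u' t) (u' t)" for t
  have D: "(e has_real_derivative 2 * (1 + \<kappa>\<^sup>2) * inner (u t) (u' t)) (at t)" for t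
  proof -
    have "(e has_vector_derivative (inner (u t) (u' t) + inner (u' t) (u t))
       + (inner (u' t) (\<i> * of_real (real l + 2 * \<mu> * cos t) * u' t + of_real (\<kappa>\<^sup>2) * u t)
        + inner (\<i> * of_real (real l + 2 * \<mu> * cos t) * u' t + of_real (\<kappa>\<^sup>2) * u t) (u' t))) (at t)"
      unfolding e_def
      by (intro has_vector_derivative_add bounded_bilinear.has_vector_derivative[OF bounded_bilinear_inner]
          heun_solutionD[OF u])
    moreover have "(inner v w + inner w v) + (inner w (\<i> * of_real g * w + of_real k * v)
       + inner (\<i> * of_real g * w + of_real k * v) w) = 2 * (1 + k) * inner v w" for v w :: complex and g k
      by (simp add: inner_complex_def algebra_simps)
    ultimately show ?thesis
      unfolding has_real_derivative_iff_has_vector_derivative by (simp only:)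
  qed
  have "e T \<le> 0 * T * exp ((1 + \<kappa>\<^sup>2) * T)"
  proof (rule gronwall_zero[OF T D])
    show "2 * (1 + \<kappa>\<^sup>2) * inner (u t) (u' t) \<le> (1 + \<kappa>\<^sup>2) * e t + 0" for t
    proof -
      have "0 \<le> inner (u t - u' t) (u t - u' t)" by simp
      then have "2 * inner (u t) (u' t) \<le> e t"
        by (simp add: e_def inner_diff_left inner_diff_right inner_commute)
      then have "(1 + \<kappa>\<^sup>2) * (2 * inner (u t) (u' t)) \<le> (1 + \<kappa>\<^sup>2) * e t"
        by (intro mult_left_mono) auto
      then show ?thesis by (simp add: algebra_simps)
    qed
  qed (use 0 in \<open>auto simp: e_def\<close>)
  then have "e T = 0" by (intro antisym) (auto simp: e_def)
  then show ?thesis by (simp add: e_def add_nonneg_eq_0_iff)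
qed

lemma has_vector_derivative_shift:
  assumes "\<And>t. (u has_vector_derivative u' t) (at t)"
  shows "((\<lambda>t. u (t + c)) has_vector_derivative u' (t + c)) (at t)"
proof -
  have "((\<lambda>t. t + c) has_real_derivative 1) (at t)" by (auto intro!: derivative_eq_intros)
  then have "((\<lambda>t. t + c) has_vector_derivative 1) (at t)"
    by (simp add: has_real_derivative_iff_has_vector_derivative)
  from vector_diff_chain_at[OF this assms] show ?thesis by (simp add: o_def)
qed

lemma periodic_derivative:
  assumes u: "\<And>t. (u has_vector_derivative u' t) (at t)" and per: "\<And>t. u (t + c) = u t"
  shows "u' (t + c) = u' t"
  using has_vector_derivative_shift[OF u, of c t] u[of t] unfolding per
  by (rule vector_derivative_unique_at)

lemma circle_coeff_heun_rhs:
  assumes u: "continuous_on UNIV u" and v: "continuous_on UNIV v"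
  shows "circle_coeff (\<lambda>t. \<i> * of_real (real l + 2 * \<mu> * cos t) * v t + of_real (\<kappa>\<^sup>2) * u t) n
    = \<i> * (of_nat l * circle_coeff v n + of_real \<mu> * (circle_coeff v (n - 1) + circle_coeff v (n + 1)))
      + of_real (\<kappa>\<^sup>2) * circle_coeff u n"
proof -
  have c: "continuous_on {0..2*pi} u" "continuous_on {0..2*pi} v"
    using u v by (meson continuous_on_subset subset_UNIV)+
  have "\<i> * of_real (real l + 2 * \<mu> * cos t) * v t + of_real (\<kappa>\<^sup>2) * u t
     = (\<i> * of_nat l) * v t + ((\<i> * of_real \<mu>) * (cis t * v t) + (\<i> * of_real \<mu>) * (cis (- t) * v t)) + of_real (\<kappa>\<^sup>2) * u t" for t
  proof -
    have "of_real (2 * cos t) = cis t + cis (- t)" by (simp add: complex_eq_iff)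
    then have "of_real (real l + 2 * \<mu> * cos t) = of_nat l + of_real \<mu> * (cis t + cis (- t))"
      by (metis (no_types, opaque_lifting) mult.assoc mult.commute of_real_add of_real_mult of_real_of_nat_eq)
    then show ?thesis by (simp add: algebra_simps)
  qed
  then have "circle_coeff (\<lambda>t. \<i> * of_real (real l + 2 * \<mu> * cos t) * v t + of_real (\<kappa>\<^sup>2) * u t) n
    = circle_coeff (\<lambda>t. (\<i> * of_nat l) * v t + ((\<i> * of_real \<mu>) * (cis t * v t) + (\<i> * of_real \<mu>) * (cis (- t) * v t)) + of_real (\<kappa>\<^sup>2) * u t) n"
    by presburger
  also have "\<dots> = (\<i> * of_nat l) * circle_coeff v n + ((\<i> * of_real \<mu>) * circle_coeff v (n - 1)
      + (\<i> * of_real \<mu>) * circle_coeff v (n + 1)) + of_real (\<kappa>\<^sup>2) * circle_coeff u n"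
    by (simp add: circle_coeff_add circle_coeff_cmult circle_coeff_shift_1 c continuous_intros del: of_real_power)
  finally show ?thesis by (simp add: algebra_simps)
qed

text \<open>The factors \<open>n - 1\<close> and \<open>n + 1\<close> vanish at \<open>n = 1\<close> and \<open>n = - 1\<close>, so the recursion decouples the
  positive modes from the negative ones.\<close>
lemma heun_recursion_iff:
  assumes u: "\<And>t. (u has_vector_derivative u' t) (at t)" and u': "\<And>t. (u' has_vector_derivative u'' t) (at t)"
    and cont: "continuous_on UNIV u''" and per: "\<And>t. u (t + 2 * pi) = u t"
  shows "heun_solution l \<mu> \<kappa> u u' \<longleftrightarrow> (\<forall>n. (of_int n ^ 2 - of_nat l * of_int n + of_real (\<kappa>\<^sup>2)) * circle_coeff u n
     = of_real \<mu> * (of_int (n - 1) * circle_coeff u (n - 1) + of_int (n + 1) * circle_coeff u (n + 1)))"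
proof -
  have cu: "continuous_on S u" "continuous_on S u'" for S
    using u u' by (blast intro: has_vector_derivative_continuous_on)+
  have per': "u' (t + 2 * pi) = u' t" for t by (rule periodic_derivative[OF u per])
  have per'': "u'' (t + 2 * pi) = u'' t" for t by (rule periodic_derivative[OF u' per'])
  \<comment> \<open>The residual of the equation is continuous and periodic, so it vanishes exactly
    when all its modes do.\<close>
  define d where "d t = u'' t - (\<i> * of_real (real l + 2 * \<mu> * cos t) * u' t + of_real (\<kappa>\<^sup>2) * u t)" for t
  have dcont: "continuous_on UNIV d" unfolding d_def by (intro continuous_intros cont cu)
  have dper: "d (t + 2 * pi) = d t" for t by (simp add: d_def per per' per'')
  have c1: "circle_coeff u' n = \<i> * of_int n * circle_coeff u n" for n
    using circle_coeff_deriv[OF u cu(2)] per[of 0] by simp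
  have c2: "circle_coeff u'' n = \<i> * of_int n * circle_coeff u' n" for n
    using circle_coeff_deriv[OF u' cont] per'[of 0] by simp
  have dn: "circle_coeff d n = of_real \<mu> * (of_int (n - 1) * circle_coeff u (n - 1) + of_int (n + 1) * circle_coeff u (n + 1))
      - (of_int n ^ 2 - of_nat l * of_int n + of_real (\<kappa>\<^sup>2)) * circle_coeff u n" for n
  proof -
    have "circle_coeff d n = circle_coeff u'' n
       - circle_coeff (\<lambda>t. \<i> * of_real (real l + 2 * \<mu> * cos t) * u' t + of_real (\<kappa>\<^sup>2) * u t) n"
      unfolding d_def by (intro circle_coeff_diff continuous_intros cu continuous_on_subset[OF cont]) auto
    then show ?thesis
      unfolding circle_coeff_heun_rhs[OF cu] c2 c1 by (simp add: algebra_simps power2_eq_square)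
  qed
  have "heun_solution l \<mu> \<kappa> u u' \<longleftrightarrow> (\<forall>t. d t = 0)"
  proof
    assume "heun_solution l \<mu> \<kappa> u u'"
    then show "\<forall>t. d t = 0"
      unfolding d_def using vector_derivative_unique_at[OF u'] heun_solutionD(2) by fastforce
  next
    assume "\<forall>t. d t = 0"
    then have "u'' = (\<lambda>t. \<i> * of_real (real l + 2 * \<mu> * cos t) * u' t + of_real (\<kappa>\<^sup>2) * u t)"
      by (auto simp: d_def)
    then show "heun_solution l \<mu> \<kappa> u u'" using u u' unfolding heun_solution_def by metis
  qed
  also have "\<dots> \<longleftrightarrow> (\<forall>n. circle_coeff d n = 0)"
  proof
    assume "\<forall>t. d t = 0"
    then have "d = (\<lambda>t. 0)" by auto
    then show "\<forall>n. circle_coeff d n = 0" by (simp add: circle_coeff_def)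
  next
    assume "\<forall>n. circle_coeff d n = 0"
    then show "\<forall>t. d t = 0" using circle_coeff_unique[OF dcont dper] by blast
  qed
  finally show ?thesis unfolding dn right_minus_eq by (metis (no_types, lifting))
qed

lemma heun_recursion:
  assumes u: "heun_solution l \<mu> \<kappa> u u'" and per: "\<And>t. u (t + 2 * pi) = u t"
  shows "(of_int n ^ 2 - of_nat l * of_int n + of_real (\<kappa>\<^sup>2)) * circle_coeff u n
     = of_real \<mu> * (of_int (n - 1) * circle_coeff u (n - 1) + of_int (n + 1) * circle_coeff u (n + 1))"
proof -
  have "continuous_on UNIV (\<lambda>t. \<i> * of_real (real l + 2 * \<mu> * cos t) * u' t + of_real (\<kappa>\<^sup>2) * u t)"
    by (intro continuous_intros heun_solution_continuous_on[OF u])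
  from heun_recursion_iff[where l = l and \<mu> = \<mu> and \<kappa> = \<kappa>, OF heun_solutionD[OF u] this per] u show ?thesis by blast
qed

text \<open>Weighted by \<open>n\<close>, the modes are those of \<open>u'\<close>, hence bounded,
  and the right side of the recursion becomes \<mu> times the sum of two neighbours. Once
  \<open>n\<close> exceeds \<open>l + 4 \<bar>\<mu>\<bar>\<close> the quadratic factor is at least
  \<open>4 \<bar>\<mu>\<bar> n\<close>, which is the hypothesis of \<open>geometric_decay\<close>.
  The sign \<open>\<epsilon>\<close> selects the end of the mode sequence.\<close>

lemma heun_coeff_decay:
  assumes u: "heun_solution l \<mu> \<kappa> u u'" and per: "\<And>t. u (t + 2 * pi) = u t" and \<mu>: "\<mu> \<noteq> 0" and \<epsilon>: "\<bar>\<epsilon>\<bar> = (1::int)"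
  obtains C where "\<And>n. norm (circle_coeff u (\<epsilon> * int n)) \<le> C * (1/2) ^ n"
proof -
  let ?c = "circle_coeff u"
  define x where "x n = real n * norm (?c (\<epsilon> * int n))" for n
  have cu: "continuous_on S u" "continuous_on S u'" for S by (rule heun_solution_continuous_on[OF u])+
  have x_eq: "x n = norm (circle_coeff u' (\<epsilon> * int n))" for n
  proof -
    have "circle_coeff u' (\<epsilon> * int n) = \<i> * of_int (\<epsilon> * int n) * ?c (\<epsilon> * int n)"
      using circle_coeff_deriv[OF heun_solutionD(1)[OF u] cu(2)] per[of 0] by simp
    moreover have "\<bar>real_of_int \<epsilon>\<bar> = 1" using \<epsilon> by linarith
    ultimately show ?thesis by (simp add: x_def norm_mult)
  qed
  obtain M where M: "\<And>n. norm (circle_coeff u' n) \<le> M" using norm_circle_coeff_le[OF cu(2)] by metis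
  obtain N :: nat where N: "real N \<ge> real l + 4 * \<bar>\<mu>\<bar>" using real_arch_simple by blast
  have rec: "x (Suc n) \<le> (x n + x (Suc (Suc n))) / 4" if n: "n \<ge> N" for n
  proof -
    let ?m = "\<epsilon> * int (Suc n)"
    have abs_eps: "real_of_int \<epsilon> = 1 \<or> real_of_int \<epsilon> = - 1" using \<epsilon> by linarith
    have big: "4 * \<bar>\<mu>\<bar> * real (Suc n) \<le> (real_of_int ?m)\<^sup>2 - real l * real_of_int ?m + \<kappa>\<^sup>2"
    proof -
      have "4 * \<bar>\<mu>\<bar> * real (Suc n) \<le> (real (Suc n) - real l) * real (Suc n)"
        using n N by (intro mult_right_mono) auto
      also have "\<dots> \<le> (real_of_int ?m)\<^sup>2 - real l * real_of_int ?m"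
        using abs_eps by (auto simp: power2_eq_square algebra_simps)
      finally show ?thesis using zero_le_power2[of \<kappa>] by linarith
    qed
    have "4 * \<bar>\<mu>\<bar> * x (Suc n) = (4 * \<bar>\<mu>\<bar> * real (Suc n)) * norm (?c ?m)" by (simp add: x_def)
    also have "\<dots> \<le> \<bar>(real_of_int ?m)\<^sup>2 - real l * real_of_int ?m + \<kappa>\<^sup>2\<bar> * norm (?c ?m)"
      using big by (intro mult_right_mono) auto
    also have "\<dots> = norm ((of_int ?m ^ 2 - of_nat l * of_int ?m + of_real (\<kappa>\<^sup>2)) * ?c ?m)"
    proof -
      have "(of_int ?m ^ 2 - of_nat l * of_int ?m + of_real (\<kappa>\<^sup>2) :: complex)
         = of_real ((real_of_int ?m)\<^sup>2 - real l * real_of_int ?m + \<kappa>\<^sup>2)" by simp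
      then show ?thesis by (simp only: norm_mult norm_of_real)
    qed
    also have "\<dots> = norm (of_real \<mu> * (of_int (?m - 1) * ?c (?m - 1) + of_int (?m + 1) * ?c (?m + 1)))"
      unfolding heun_recursion[OF u per] ..
    also have "\<dots> \<le> \<bar>\<mu>\<bar> * (\<bar>real_of_int (?m - 1)\<bar> * norm (?c (?m - 1)) + \<bar>real_of_int (?m + 1)\<bar> * norm (?c (?m + 1)))"
    proof -
      have "norm (of_real \<mu> * (of_int i * a + of_int j * b))
          \<le> \<bar>\<mu>\<bar> * (\<bar>real_of_int i\<bar> * norm a + \<bar>real_of_int j\<bar> * norm b)" for i j and a b :: complex
      proof -
        have "norm (of_int i * a + of_int j * b) \<le> \<bar>real_of_int i\<bar> * norm a + \<bar>real_of_int j\<bar> * norm b"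
          using norm_triangle_ineq[of "of_int i * a" "of_int j * b"] by (simp add: norm_mult)
        then show ?thesis by (simp add: norm_mult mult_left_mono)
      qed
      then show ?thesis .
    qed
    also have "\<dots> = \<bar>\<mu>\<bar> * (x n + x (Suc (Suc n)))"
    proof -
      have "\<epsilon> = 1 \<or> \<epsilon> = - 1" using \<epsilon> by linarith
      then show ?thesis
      proof
        assume "\<epsilon> = 1"
        moreover have "int (Suc n) + 1 = int (Suc (Suc n))" "int (Suc n) - 1 = int n" by auto
        ultimately show ?thesis by (simp add: x_def)
      next
        assume e: "\<epsilon> = - 1"
        have "- int (Suc n) - 1 = - int (Suc (Suc n))" "- int (Suc n) + 1 = - int n" by auto
        with e show ?thesis by (simp add: x_def add.commute abs_if)
      qed
    qed
    finally have "\<bar>\<mu>\<bar> * (4 * x (Suc n)) \<le> \<bar>\<mu>\<bar> * (x n + x (Suc (Suc n)))" by simp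
    then show ?thesis using \<mu> by (simp add: mult_le_cancel_left)
  qed
  obtain C where C: "0 \<le> C" "\<And>n. x n \<le> C * (1/2) ^ n"
    by (rule geometric_decay[of x M N, OF _ rec]) (auto simp: x_eq M)
  show thesis
  \<comment> \<open>The weight \<open>n\<close> loses the zero mode, which is added by hand.\<close>
  proof (rule that[of "C + norm (?c 0)"])
    fix n
    show "norm (?c (\<epsilon> * int n)) \<le> (C + norm (?c 0)) * (1/2) ^ n"
    proof (cases "n = 0")
      case False
      then have "norm (?c (\<epsilon> * int n)) \<le> x n" unfolding x_def by (intro mult_le_cancel_right1[THEN iffD2]) auto
      also have "\<dots> \<le> (C + norm (?c 0)) * (1/2) ^ n"
        by (intro order.trans[OF C(2)] mult_right_mono) auto
      finally show ?thesis .
    qed (use C in auto)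
  qed
qed

lemma has_vector_derivative_circle_holomorphic:
  assumes "F holomorphic_on ball 0 r" "r > 1"
  shows "((\<lambda>t. F (cis t)) has_vector_derivative \<i> * (cis t * deriv F (cis t))) (at t)"
proof -
  have "(F has_field_derivative deriv F (cis t)) (at (cis t))"
    using assms by (intro holomorphic_derivI[of F "ball 0 r"]) auto
  moreover have "((\<lambda>t. cis t) has_vector_derivative \<i> * cis t) (at t)"
    using has_vector_derivative_cis[OF DERIV_ident] by simp
  ultimately show ?thesis
    using field_vector_diff_chain_at[of cis "\<i> * cis t" t F "deriv F (cis t)"]
    by (simp add: o_def mult_ac)
qed

text \<open>\<open>cnj (G (cis t))\<close> has nonpositive modes only; its zero mode \<open>c0\<close> is the share of the zero mode of \<open>u\<close>
  that the recursion at \<open>n = 0\<close> assigns to the negative modes.\<close>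
lemma heun_negative_part:
  assumes u: "heun_solution l \<mu> \<kappa> u u'" and per: "\<And>t. u (t + 2 * pi) = u t" and \<mu>: "\<mu> \<noteq> 0" and \<kappa>: "\<kappa> > 0"
  obtains G where "G holomorphic_on ball 0 2"
    and "heun_solution l \<mu> \<kappa> (\<lambda>t. cnj (G (cis t))) (\<lambda>t. cnj (\<i> * (cis t * deriv G (cis t))))"
    and "\<And>n. n < 0 \<Longrightarrow> circle_coeff (\<lambda>t. cnj (G (cis t))) n = circle_coeff u n"
proof -
  let ?c = "circle_coeff u"
  obtain C where C: "\<And>n. norm (?c (- 1 * int n)) \<le> C * (1/2) ^ n"
    using heun_coeff_decay[OF u per \<mu>, of "- 1"] by auto
  define c0 where "c0 = - (of_real \<mu> * ?c (- 1) / of_real (\<kappa>\<^sup>2))"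
  \<comment> \<open>Conjugation sends the power \<open>n\<close> of \<open>cis t\<close> to the mode
    \<open>- n\<close>, and \<open>circle_coeff\<close> carries a factor 2 pi; \<open>b\<close>
    undoes both.\<close>
  define b where "b n = cnj (if n = 0 then c0 else ?c (- int n)) / of_real (2 * pi)" for n :: nat
  have b: "norm (b n) \<le> (norm c0 + C) * (1/2) ^ n" for n
  proof -
    have "norm (b n) \<le> norm (if n = 0 then c0 else ?c (- int n))"
    proof -
      have "norm (b n) = norm (if n = 0 then c0 else ?c (- int n)) / (2 * pi)"
        unfolding b_def by (simp add: norm_divide norm_mult)
      also have "\<dots> \<le> norm (if n = 0 then c0 else ?c (- int n)) / 1"
        using pi_gt3 by (intro divide_left_mono) auto
      finally show ?thesis by simp
    qed
    also have "\<dots> \<le> (norm c0 + C) * (1/2) ^ n"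
    proof -
      have "0 \<le> C" using order_trans[OF norm_ge_zero C[of 0]] by simp
      then show ?thesis using C[of n] by (auto simp: distrib_right intro: add_increasing)
    qed
    finally show ?thesis .
  qed
  define G where "G = power_sum b"
  have G: "G holomorphic_on ball 0 2" unfolding G_def by (rule power_sum_holomorphic[OF b])
  define U where "U t = cnj (G (cis t))" for t
  define G1 where "G1 z = \<i> * (z * deriv G z)" for z
  have G1: "G1 holomorphic_on ball 0 2" unfolding G1_def by (intro holomorphic_intros G open_ball)
  have U: "(U has_vector_derivative cnj (G1 (cis t))) (at t)" for t
    unfolding U_def G1_def by (intro has_vector_derivative_cnj has_vector_derivative_circle_holomorphic[OF G]) auto
  have U': "((\<lambda>t. cnj (G1 (cis t))) has_vector_derivative cnj (\<i> * (cis t * deriv G1 (cis t)))) (at t)" for t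
    by (intro has_vector_derivative_cnj has_vector_derivative_circle_holomorphic[OF G1]) auto
  have "continuous_on UNIV (\<lambda>t. deriv G1 (cis t))"
    by (rule continuous_on_compose2[of "ball 0 2" "deriv G1" UNIV cis])
      (auto intro!: holomorphic_on_imp_continuous_on holomorphic_deriv G1 continuous_intros)
  then have cont: "continuous_on UNIV (\<lambda>t. cnj (\<i> * (cis t * deriv G1 (cis t))))"
    by (intro continuous_intros)
  have Uper: "U (t + 2 * pi) = U t" for t
    unfolding U_def by (simp add: cis_mult[symmetric])
  have coeff: "circle_coeff U n = (if n < 0 then ?c n else if n = 0 then c0 else 0)" for n
  proof -
    have "circle_coeff U n = cnj (circle_coeff (\<lambda>t. power_sum b (cis t)) (- n))"
      unfolding U_def G_def by (rule circle_coeff_cnj)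
    also have "\<dots> = (if n < 0 then ?c n else if n = 0 then c0 else 0)"
      unfolding circle_coeff_power_sum[OF b] by (auto simp: b_def)
    finally show ?thesis .
  qed
  have rec: "(of_int n ^ 2 - of_nat l * of_int n + of_real (\<kappa>\<^sup>2)) * circle_coeff U n
     = of_real \<mu> * (of_int (n - 1) * circle_coeff U (n - 1) + of_int (n + 1) * circle_coeff U (n + 1))" for n
  proof -
    \<comment> \<open>Replacing the zero mode by \<open>c0\<close> and dropping the positive modes
      is invisible at \<open>n = - 1\<close>; at \<open>n = 0\<close> it is balanced by the choice
      of \<open>c0\<close>.\<close>
    consider "n \<le> - 2" | "n = - 1" | "n = 0" | "n = 1" | "n \<ge> 2" by linarith
    then show ?thesis
    proof cases
      case 1
      then have "n < 0" "n - 1 < 0" "n + 1 < 0" by auto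
      then show ?thesis using heun_recursion[OF u per, of n] unfolding coeff by simp
    next
      case 2
      then show ?thesis using heun_recursion[OF u per, of n] unfolding coeff by simp
    next
      case 3
      then show ?thesis using \<kappa> by (simp add: coeff c0_def)
    qed (auto simp: coeff)
  qed
  have "heun_solution l \<mu> \<kappa> U (\<lambda>t. cnj (G1 (cis t)))"
    using heun_recursion_iff[OF U U' cont Uper] rec by blast
  with G coeff show thesis by (intro that[of G]) (auto simp: U_def[abs_def] G1_def)
qed

section \<open>Lifting orbits to solutions of the linear equation\<close>

text \<open>The equation for \<open>cis f\<close> is of Riccati type, and
  \<open>w = spinor l \<mu> E f\<close> linearises it: \<open>cis (f t)\<close> is
  \<open>cis (l t + 2 \<mu> sin t)\<close> times \<open>cnj w / w\<close>. Recovering the orbit from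
  such a quotient is what forces the half angle.\<close>

definition spinor :: "nat \<Rightarrow> real \<Rightarrow> (real \<Rightarrow> real) \<Rightarrow> (real \<Rightarrow> real) \<Rightarrow> real \<Rightarrow> complex" where
  "spinor l \<mu> E f t = of_real (sqrt (E t)) * cis ((real l * t + 2 * \<mu> * sin t - f t) / 2)"

lemma spinor_norm: "E t > 0 \<Longrightarrow> (cmod (spinor l \<mu> E f t))\<^sup>2 = E t"
  by (simp add: spinor_def norm_mult)

text \<open>The modulus has logarithmic derivative \<open>\<kappa> cos f\<close> and the phase has
  derivative \<open>\<kappa> sin f\<close>, so \<open>w' = \<kappa> cis f w\<close>; then
  \<open>cis f w\<close> is rewritten through \<open>cnj w\<close>, which removes
  \<open>f\<close>.\<close>

lemma spinor_derivative:
  assumes f: "torus_solution (2 * \<kappa>) (real l) (2 * \<mu>) f" and E: "variation_weight (2 * \<kappa>) f E"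
  shows "(spinor l \<mu> E f has_vector_derivative
      of_real \<kappa> * (cis (real l * t + 2 * \<mu> * sin t) * cnj (spinor l \<mu> E f t))) (at t)"
proof -
  let ?g = "\<lambda>t. (real l * t + 2 * \<mu> * sin t - f t) / 2"
  have Epos: "E t > 0" and E': "(E has_real_derivative 2 * \<kappa> * cos (f t) * E t) (at t)" for t
    using E by (auto simp: variation_weight_def)
  have "((\<lambda>t. sqrt (E t)) has_real_derivative (2 * \<kappa> * cos (f t) * E t) * (inverse (sqrt (E t)) / 2)) (at t)"
    using DERIV_chain2[OF DERIV_real_sqrt[OF Epos] E'] by (simp add: mult.commute)
  also have "(2 * \<kappa> * cos (f t) * E t) * (inverse (sqrt (E t)) / 2) = \<kappa> * cos (f t) * sqrt (E t)"
  proof -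
    have "E t * inverse (sqrt (E t)) = sqrt (E t)"
      using Epos[of t] by (simp add: divide_inverse[symmetric] real_div_sqrt)
    then show ?thesis by (metis (no_types, opaque_lifting) mult.assoc mult.commute nonzero_mult_div_cancel_left times_divide_eq_right zero_neq_numeral)
  qed
  finally have 1: "((\<lambda>t. complex_of_real (sqrt (E t))) has_vector_derivative of_real (\<kappa> * cos (f t) * sqrt (E t))) (at t)"
    by (rule has_vector_derivative_of_real)
  have "(?g has_real_derivative \<kappa> * sin (f t)) (at t)"
    by (rule derivative_eq_intros torus_solutionD[OF f] refl | simp)+
  note 2 = has_vector_derivative_cis[OF this]
  have eq: "cis (real l * t + 2 * \<mu> * sin t) * cnj (spinor l \<mu> E f t) = cis (f t) * spinor l \<mu> E f t"
  proof -
    have "(real l * t + 2 * \<mu> * sin t) + - ?g t = f t + ?g t" by (simp add: field_simps)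
    then have "cis (real l * t + 2 * \<mu> * sin t) * cis (- ?g t) = cis (f t) * cis (?g t)"
      by (simp only: cis_mult)
    then show ?thesis by (simp add: spinor_def cis_cnj mult.left_commute)
  qed
  have "cis (f t) = of_real (cos (f t)) + \<i> * of_real (sin (f t))" by (simp add: complex_eq_iff)
  then show ?thesis
    unfolding eq using has_vector_derivative_mult[OF 1 2]
    by (simp add: spinor_def[abs_def] algebra_simps)
qed

text \<open>Differentiating once more applies the conjugation twice, which turns the antilinear
  first-order equation into a complex-linear one of second order.\<close>

lemma spinor_heun:
  assumes f: "torus_solution (2 * \<kappa>) (real l) (2 * \<mu>) f" and E: "variation_weight (2 * \<kappa>) f E"
  shows "heun_solution l \<mu> \<kappa> (spinor l \<mu> E f)
     (\<lambda>t. of_real \<kappa> * (cis (real l * t + 2 * \<mu> * sin t) * cnj (spinor l \<mu> E f t)))"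
  unfolding heun_solution_def
proof (intro allI conjI spinor_derivative[OF f E])
  fix t
  let ?p = "\<lambda>t. real l * t + 2 * \<mu> * sin t" and ?w = "spinor l \<mu> E f"
  have "(?p has_real_derivative real l + 2 * \<mu> * cos t) (at t)" by (auto intro!: derivative_eq_intros)
  note 1 = has_vector_derivative_cis[OF this]
  have "((\<lambda>t. of_real \<kappa> * (cis (?p t) * cnj (?w t))) has_vector_derivative
     of_real \<kappa> * (cis (?p t) * cnj (of_real \<kappa> * (cis (?p t) * cnj (?w t)))
       + \<i> * of_real (real l + 2 * \<mu> * cos t) * cis (?p t) * cnj (?w t))) (at t)"
    by (intro has_vector_derivative_mult_right has_vector_derivative_mult 1 has_vector_derivative_cnj spinor_derivative[OF f E])
  moreover have "cis (?p t) * cnj (of_real \<kappa> * (cis (?p t) * cnj (?w t))) = of_real \<kappa> * ?w t"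
  proof -
    have "cis (?p t) * cnj (of_real \<kappa> * (cis (?p t) * cnj (?w t))) = of_real \<kappa> * (cis (?p t) * cis (- ?p t)) * ?w t"
      by (simp add: cis_cnj)
    then show ?thesis by (simp add: cis_mult)
  qed
  moreover have "of_real \<kappa> * (of_real \<kappa> * z + \<i> * g * c * y) = \<i> * g * (of_real \<kappa> * (c * y)) + of_real (\<kappa>\<^sup>2) * z"
    for z g c y :: complex by (simp add: algebra_simps power2_eq_square)
  ultimately show "((\<lambda>t. of_real \<kappa> * (cis (?p t) * cnj (?w t))) has_vector_derivative
       \<i> * of_real (real l + 2 * \<mu> * cos t) * (of_real \<kappa> * (cis (?p t) * cnj (?w t))) + of_real (\<kappa>\<^sup>2) * ?w t) (at t)"
    by (simp only:)
qed

text \<open>Since \<open>cos (f 0) = 0\<close>, the angle \<open>2 * f 0\<close> is an odd multiple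
  of pi and reflecting the phase in \<open>f 0\<close> preserves the sine. Combined with time
  reversal this is a symmetry of the equation that fixes the initial point.\<close>

lemma torus_solution_reflect:
  assumes f: "torus_solution a b c f" and cos0: "cos (f 0) = 0"
  shows "f (- t) = 2 * f 0 - f t"
proof -
  have c2: "cos (2 * f 0) = - 1" "sin (2 * f 0) = 0" using cos0 by (simp_all add: cos_double_cos sin_double)
  have "torus_solution a b c (\<lambda>t. 2 * f 0 - f (- t))"
    unfolding torus_solution_def
  proof
    fix t
    have "(f has_real_derivative - a * sin (f (- t)) + b + c * cos (- t)) (at (- t))" by (rule torus_solutionD[OF f])
    from DERIV_chain2[where f = f, OF this DERIV_minus[OF DERIV_ident]]
    have "((\<lambda>t. f (- t)) has_real_derivative - (- a * sin (f (- t)) + b + c * cos t)) (at t)" by simp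
    then have *: "((\<lambda>t. 2 * f 0 - f (- t)) has_real_derivative 0 - - (- a * sin (f (- t)) + b + c * cos t)) (at t)"
      by (intro DERIV_diff DERIV_const)
    show "((\<lambda>t. 2 * f 0 - f (- t)) has_real_derivative - a * sin (2 * f 0 - f (- t)) + b + c * cos t) (at t)"
    proof -
      have "sin (2 * f 0 - f (- t)) = sin (f (- t))" by (simp add: sin_diff c2)
      with * show ?thesis by (simp add: algebra_simps)
    qed
  qed
  from torus_solution_unique[OF this f, of 0] have "(\<lambda>t. 2 * f 0 - f (- t)) = f" by simp
  from fun_cong[OF this, of t] show ?thesis by simp
qed

lemma linear_ode_ratio:
  fixes E F :: "real \<Rightarrow> real"
  assumes E: "\<And>t. (E has_real_derivative k t * E t) (at t)" and F: "\<And>t. (F has_real_derivative k t * F t) (at t)"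
    and pos: "\<And>t. F t > 0"
  shows "E t / F t = E s / F s"
proof -
  have "((\<lambda>t. E t / F t) has_real_derivative 0) (at t)" for t
    using DERIV_divide[OF E F] pos[of t] by (simp add: algebra_simps)
  then show ?thesis by (intro DERIV_isconst_all[of "\<lambda>t. E t / F t"]) blast
qed

text \<open>By the reflection \<open>cos f\<close> is odd in time, so \<open>E\<close> is even. By
  periodicity of \<open>cos f\<close> the ratio of \<open>E (t + 2 * pi)\<close> to
  \<open>E t\<close> is constant, and at \<open>t = - pi\<close> it compares \<open>E pi\<close>
  with \<open>E (- pi)\<close>.\<close>

lemma variation_weight_periodic:
  assumes f: "torus_solution a b c f" and cos0: "cos (f 0) = 0" and per: "f (2 * pi) = f 0 + 2 * pi * of_int s"
    and E: "variation_weight a f E"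
  shows "E (t + 2 * pi) = E t"
proof -
  have Epos: "E t > 0" and E': "(E has_real_derivative (a * cos (f t)) * E t) (at t)" for t
    using E by (auto simp: variation_weight_def)
  have c2: "cos (2 * f 0) = - 1" "sin (2 * f 0) = 0" using cos0 by (simp_all add: cos_double_cos sin_double)
  have even: "E (- t) = E t" for t
  proof -
    have "((\<lambda>t. E (- t)) has_real_derivative (a * cos (f t)) * E (- t)) (at t)" for t
      using DERIV_chain2[where f = E, OF E' DERIV_minus[OF DERIV_ident], of t]
      by (simp add: torus_solution_reflect[OF f cos0] cos_diff c2)
    from linear_ode_ratio[OF this E' Epos, of t 0] show ?thesis using Epos[of 0] Epos[of t] by (simp add: field_simps)
  qed
  have cosper: "cos (f (t + 2 * pi)) = cos (f t)" for t
    using torus_solution_shift[OF f per, of t] sin_cos_eq_iff[of "f t + 2 * pi * of_int s" "f t"] by auto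
  have "((\<lambda>t. E (t + 2 * pi)) has_real_derivative (a * cos (f t)) * E (t + 2 * pi)) (at t)" for t
    using DERIV_shift[of E "(a * cos (f t)) * E (t + 2 * pi)" t "2 * pi"] E'[of "t + 2 * pi"] by (simp add: cosper)
  from linear_ode_ratio[OF this E' Epos, of _ "- pi"] 
  have "E (t + 2 * pi) / E t = E (- pi + 2 * pi) / E (- pi)" .
  also have "\<dots> = 1" using even[of pi] Epos[of pi] by simp
  finally show ?thesis using Epos[of t] by simp
qed

text \<open>Over one period the half angle gains \<open>pi (l - s)\<close>, which is a whole number
  of turns because \<open>l - s\<close> is even.\<close>

lemma spinor_periodic:
  assumes f: "torus_solution (2 * \<kappa>) (real l) (2 * \<mu>) f" and E: "variation_weight (2 * \<kappa>) f E"
    and cos0: "cos (f 0) = 0" and per: "f (2 * pi) = f 0 + 2 * pi * of_int s" and even: "even (int l - s)"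
  shows "spinor l \<mu> E f (t + 2 * pi) = spinor l \<mu> E f t"
proof -
  obtain k where k: "int l - s = 2 * k" using evenE[OF even] by metis
  have "real l - of_int s = of_int (int l - s)" by simp
  then have k': "real l = of_int s + 2 * of_int k" by (simp add: k)
  have "(real l * (t + 2 * pi) + 2 * \<mu> * sin (t + 2 * pi) - f (t + 2 * pi)) / 2
     = (real l * t + 2 * \<mu> * sin t - f t) / 2 + 2 * pi * of_int k"
    unfolding torus_solution_shift[OF f per] sin_periodic by (simp add: k' field_simps)
  then show ?thesis
    unfolding spinor_def variation_weight_periodic[OF f cos0 per E]
    by (simp only: cis_mult[symmetric] cis_2pi_int mult_1_right)
qed

text \<open>The lift of any orbit is a combination of \<open>u\<close> and \<open>v\<close>, hence periodic, and an orbit is read off the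
  argument of its lift.\<close>
lemma closed_orbits_of_independent_periodic:
  assumes u: "heun_solution l \<mu> \<kappa> u u'" and v: "heun_solution l \<mu> \<kappa> v v'"
    and uper: "u (2 * pi) = u 0" and vper: "v (2 * pi) = v 0"
    and indep: "u 0 * v' 0 \<noteq> u' 0 * v 0"
  shows "\<exists>k::int. torus_flow (2 * \<kappa>) (real l) (2 * \<mu>) x (2 * pi) = x + 2 * pi * of_int k"
proof -
  define f where "f = torus_flow (2 * \<kappa>) (real l) (2 * \<mu>) x"
  have f: "torus_solution (2 * \<kappa>) (real l) (2 * \<mu>) f" and f0: "f 0 = x"
    by (simp_all add: f_def torus_flow_solution)
  obtain E where E: "variation_weight (2 * \<kappa>) f E"
    using variation_weight_exists[OF torus_solution_continuous_on[OF f]] by metis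
  define w where "w = spinor l \<mu> E f"
  define w' where "w' = (\<lambda>t. of_real \<kappa> * (cis (real l * t + 2 * \<mu> * sin t) * cnj (w t)))"
  have w: "heun_solution l \<mu> \<kappa> w w'" unfolding w_def w'_def by (rule spinor_heun[OF f E])
  define D where "D = u 0 * v' 0 - u' 0 * v 0"
  have D: "D \<noteq> 0" using indep by (simp add: D_def)
  \<comment> \<open>Cramer's rule for the data at 0, with \<open>D\<close> the Wronskian
    there.\<close>
  define \<alpha> where "\<alpha> = (w 0 * v' 0 - w' 0 * v 0) / D"
  define \<beta> where "\<beta> = (u 0 * w' 0 - u' 0 * w 0) / D"
  have init: "\<alpha> * u 0 + \<beta> * v 0 = w 0" "\<alpha> * u' 0 + \<beta> * v' 0 = w' 0"
  proof -
    have "(w 0 * v' 0 - w' 0 * v 0) * u 0 + (u 0 * w' 0 - u' 0 * w 0) * v 0 = w 0 * D"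
      "(w 0 * v' 0 - w' 0 * v 0) * u' 0 + (u 0 * w' 0 - u' 0 * w 0) * v' 0 = w' 0 * D"
      by (simp_all add: D_def algebra_simps)
    then show "\<alpha> * u 0 + \<beta> * v 0 = w 0" "\<alpha> * u' 0 + \<beta> * v' 0 = w' 0"
      using D by (simp_all add: \<alpha>_def \<beta>_def add_divide_distrib[symmetric])
  qed
  from heun_solution_lincomb[OF w heun_solution_lincomb[OF u v, of \<alpha> \<beta>], of 1 "- 1"]
  have "1 * w (2 * pi) + - 1 * (\<alpha> * u (2 * pi) + \<beta> * v (2 * pi)) = 0"
    by (rule heun_solution_zero[THEN conjunct1]) (use init in auto)
  then have wper: "w (2 * pi) = w 0" using init(1) by (simp add: uper vper)
  have Epos: "E t > 0" for t using E by (auto simp: variation_weight_def)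
  \<comment> \<open>The modulus returns and cancels from \<open>w (2 * pi) = w 0\<close>; what
    remains determines the half angle modulo full turns.\<close>
  have "E (2 * pi) = E 0"
    using wper spinor_norm[of E "2 * pi" l \<mu> f, OF Epos] spinor_norm[of E 0 l \<mu> f, OF Epos] by (simp add: w_def)
  then have "cis ((real l * (2 * pi) - f (2 * pi)) / 2) = cis (- x / 2)"
    using wper Epos[of 0] f0 by (simp add: w_def spinor_def)
  then obtain n :: int where "(real l * (2 * pi) - f (2 * pi)) / 2 = - x / 2 + 2 * pi * n"
    using sin_cos_eq_iff[of "(real l * (2 * pi) - f (2 * pi)) / 2" "- x / 2"] by (auto simp: complex_eq_iff)
  then have "f (2 * pi) = x + 2 * pi * of_int (int l - 2 * n)" by (simp add: field_simps)
  then show ?thesis unfolding f_def by blast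
qed

text \<open>With \<open>z = cis t\<close>, \<open>2 \<i> sin t\<close> is \<open>z - 1 / z\<close>.
  This splits the phase into a factor holomorphic in the disc and one whose conjugate is.\<close>

lemma cis_phase_factor:
  "cis (real l * t + 2 * \<mu> * sin t) = cis t ^ l * exp (of_real \<mu> * cis t) * exp (- of_real \<mu> * cis (- t))"
proof -
  have "exp (of_real \<mu> * cis t) * exp (- of_real \<mu> * cis (- t)) = exp (of_real \<mu> * (cis t - cis (- t)))"
    by (simp add: exp_add[symmetric] algebra_simps)
  also have "of_real \<mu> * (cis t - cis (- t)) = \<i> * of_real (2 * \<mu> * sin t)"
    by (simp add: complex_eq_iff)
  also have "exp \<dots> = cis (2 * \<mu> * sin t)" by (simp only: cis_conv_exp)
  finally show ?thesis by (simp only: Complex.DeMoivre cis_mult mult.assoc)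
qed

lemma cnj_exp_cis: "cnj (exp (of_real \<mu> * cis t)) = exp (of_real \<mu> * cis (- t))"
  by (simp add: exp_cnj cis_cnj)

text \<open>A solution with nonpositive modes only would make \<open>\<kappa> z ^ l exp (\<mu> z) cnj w\<close> (modes \<open>\<ge> 0\<close>) equal to
  \<open>exp (\<mu> / z) w'\<close> (modes \<open>< 0\<close>), so both would vanish.\<close>
lemma spinor_not_antiholomorphic:
  assumes w: "\<And>t. (w has_vector_derivative of_real \<kappa> * (cis (real l * t + 2 * \<mu> * sin t) * cnj (w t))) (at t)"
    and nz: "w 0 \<noteq> 0" and \<kappa>: "\<kappa> > 0" and G: "G holomorphic_on ball 0 2"
    and eq: "\<And>t. t \<in> {0..2*pi} \<Longrightarrow> w t = cnj (G (cis t))"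
    and eq': "\<And>t. t \<in> {0..2*pi} \<Longrightarrow>
      of_real \<kappa> * (cis (real l * t + 2 * \<mu> * sin t) * cnj (w t)) = cnj (\<i> * (cis t * deriv G (cis t)))"
  shows False
proof -
  \<comment> \<open>On the circle \<open>z H z\<close> is the squared modulus of \<open>X\<close>:
    one factor is \<open>X\<close> written through \<open>G\<close>, the other is its conjugate
    written through the derivative of \<open>G\<close>. The extra \<open>z\<close> makes the circle
    integral vanish.\<close>
  define H where "H z = of_real \<kappa> * z ^ l * exp (of_real \<mu> * z) * G z * exp (of_real \<mu> * z) * \<i> * deriv G z" for z
  have H: "H holomorphic_on ball 0 2" unfolding H_def by (intro holomorphic_intros G open_ball)
  define X where "X t = of_real \<kappa> * cis t ^ l * exp (of_real \<mu> * cis t) * cnj (w t)" for t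
  have key: "of_real ((cmod (X t))\<^sup>2) = cis t * H (cis t)" if t: "t \<in> {0..2*pi}" for t
  proof -
    let ?P = "exp (of_real \<mu> * cis t)"
    have "?P * exp (- of_real \<mu> * cis t) = 1" by (simp add: exp_add[symmetric])
    have one: "exp (- of_real \<mu> * cis (- t)) * cnj ?P = 1" unfolding cnj_exp_cis by (simp add: exp_add[symmetric])
    have "X t = X t * (exp (- of_real \<mu> * cis (- t)) * cnj ?P)" by (simp only: one mult_1_right)
    also have "\<dots> = cnj ?P * (of_real \<kappa> * (cis (real l * t + 2 * \<mu> * sin t) * cnj (w t)))"
      unfolding X_def cis_phase_factor by (simp only: mult_ac)
    also have "\<dots> = cnj (?P * (\<i> * (cis t * deriv G (cis t))))" unfolding eq'[OF t] complex_cnj_mult ..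
    finally have "cnj (X t) = ?P * (\<i> * (cis t * deriv G (cis t)))" by (metis complex_cnj_cnj)
    then have "X t * cnj (X t) = cis t * H (cis t)"
      unfolding H_def X_def by (simp add: eq[OF t] mult_ac)
    then show ?thesis by (simp only: complex_norm_square)
  qed
  have wc: "continuous_on S w" for S using w by (rule has_vector_derivative_continuous_on)
  have c: "continuous_on {0..2*pi} (\<lambda>t. (cmod (X t))\<^sup>2)" unfolding X_def by (intro continuous_intros wc)
  have "((\<lambda>t. complex_of_real ((cmod (X t))\<^sup>2)) has_integral
      complex_of_real (integral {0..2*pi} (\<lambda>t. (cmod (X t))\<^sup>2))) {0..2*pi}"
    using has_integral_linear[OF integrable_integral[OF integrable_continuous_real[OF c]] bounded_linear_of_real]
    by (simp add: o_def)
  moreover have "integral {0..2*pi} (\<lambda>t. complex_of_real ((cmod (X t))\<^sup>2)) = integral {0..2*pi} (\<lambda>t. cis t * H (cis t))"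
    by (rule Henstock_Kurzweil_Integration.integral_cong) (rule key)
  moreover have "integral {0..2*pi} (\<lambda>t. cis t * H (cis t)) = 0"
    by (rule integral_circle_holomorphic[OF H]) simp
  ultimately have "integral {0..2*pi} (\<lambda>t. (cmod (X t))\<^sup>2) = 0"
    by (metis integral_unique of_real_eq_0_iff)
  then have "(cmod (X 0))\<^sup>2 = 0" using integral_eq_0_iff[OF c] by simp
  then show False using nz \<kappa> by (simp add: X_def)
qed

text \<open>The negative part \<open>u\<close> of \<open>w\<close> is a second periodic solution.
  Were it independent of \<open>w\<close>, every orbit would be closed; so the two are proportional,
  and a common nonzero mode makes them equal, leaving \<open>w\<close> with nonpositive modes
  only.\<close>

lemma negative_modes_vanish:
  assumes f: "torus_solution (2 * \<kappa>) (real l) (2 * \<mu>) f" and E: "variation_weight (2 * \<kappa>) f E"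
    and cos0: "cos (f 0) = 0" and per: "f (2 * pi) = f 0 + 2 * pi * of_int s" and even: "even (int l - s)"
    and \<kappa>: "\<kappa> > 0" and \<mu>: "\<mu> \<noteq> 0"
    and open_orbit: "\<And>k::int. torus_flow (2 * \<kappa>) (real l) (2 * \<mu>) x (2 * pi) \<noteq> x + 2 * pi * of_int k"
    and n: "n < 0"
  shows "circle_coeff (spinor l \<mu> E f) n = 0"
proof (rule ccontr)
  define w where "w = spinor l \<mu> E f"
  define w' where "w' t = of_real \<kappa> * (cis (real l * t + 2 * \<mu> * sin t) * cnj (w t))" for t
  assume "circle_coeff (spinor l \<mu> E f) n \<noteq> 0"
  then have nz: "circle_coeff w n \<noteq> 0" by (simp add: w_def)
  have w: "heun_solution l \<mu> \<kappa> w w'" unfolding w_def w'_def[abs_def] by (rule spinor_heun[OF f E])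
  have wper: "w (t + 2 * pi) = w t" for t unfolding w_def by (rule spinor_periodic[OF f E cos0 per even])
  obtain G where G: "G holomorphic_on ball 0 2"
    and U: "heun_solution l \<mu> \<kappa> (\<lambda>t. cnj (G (cis t))) (\<lambda>t. cnj (\<i> * (cis t * deriv G (cis t))))"
    and Uc: "\<And>n. n < 0 \<Longrightarrow> circle_coeff (\<lambda>t. cnj (G (cis t))) n = circle_coeff w n"
    by (rule heun_negative_part[OF w wper \<mu> \<kappa>]) blast
  define u where "u t = cnj (G (cis t))" for t
  define u' where "u' t = cnj (\<i> * (cis t * deriv G (cis t)))" for t
  have u: "heun_solution l \<mu> \<kappa> u u'" using U by (simp add: u_def[abs_def] u'_def[abs_def])
  have uc: "circle_coeff u n = circle_coeff w n" using Uc[OF n] by (simp add: u_def[abs_def])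
  have uper: "u (2 * pi) = u 0" by (simp add: u_def)
  have w0: "w 0 \<noteq> 0" using E by (auto simp: w_def spinor_def variation_weight_def)
  have dep: "w 0 * u' 0 = w' 0 * u 0"
    using closed_orbits_of_independent_periodic[OF w u, of x] wper[of 0] uper open_orbit by auto
  \<comment> \<open>The combination \<open>u 0 w - w 0 u\<close> has zero data at 0; its \<open>n\<close>-th mode forces \<open>u 0 = w 0\<close>.\<close>
  have zero: "u 0 * w t - w 0 * u t = 0 \<and> u 0 * w' t - w 0 * u' t = 0" if "0 \<le> t" for t
    using heun_solution_zero[OF heun_solution_lincomb[OF w u, of "u 0" "- w 0"] _ _ that] dep
    by (simp add: mult.commute)
  have "circle_coeff (\<lambda>t. u 0 * w t - w 0 * u t) n = u 0 * circle_coeff w n - w 0 * circle_coeff u n"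
    by (simp add: circle_coeff_diff circle_coeff_cmult heun_solution_continuous_on[OF w] heun_solution_continuous_on[OF u] continuous_intros)
  moreover have "circle_coeff (\<lambda>t. u 0 * w t - w 0 * u t) n = circle_coeff (\<lambda>t. 0) n"
    by (rule circle_coeff_cong) (use zero in auto)
  ultimately have u0: "u 0 = w 0" using nz uc by (simp add: circle_coeff_def left_diff_distrib[symmetric])
  have eq: "w t = u t" "w' t = u' t" if "0 \<le> t" for t
    using zero[OF that] w0 unfolding u0 by (simp_all add: right_diff_distrib[symmetric])
  show False
    by (rule spinor_not_antiholomorphic[of w \<kappa> l \<mu> G])
      (use heun_solutionD(1)[OF w] w0 \<kappa> G eq in \<open>auto simp: w'_def u_def u'_def\<close>)
qed

lemma spinor_power_sum:
  assumes f: "torus_solution (2 * \<kappa>) (real l) (2 * \<mu>) f" and E: "variation_weight (2 * \<kappa>) f E"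
    and cos0: "cos (f 0) = 0" and per: "f (2 * pi) = f 0 + 2 * pi * of_int s" and even: "even (int l - s)"
    and \<kappa>: "\<kappa> > 0" and \<mu>: "\<mu> \<noteq> 0"
    and open_orbit: "\<And>k::int. torus_flow (2 * \<kappa>) (real l) (2 * \<mu>) x (2 * pi) \<noteq> x + 2 * pi * of_int k"
  obtains a C where "\<And>n. norm (a n) \<le> C * (1/2) ^ n" "\<And>t. spinor l \<mu> E f t = power_sum a (cis t)"
proof -
  define w where "w = spinor l \<mu> E f"
  have w: "heun_solution l \<mu> \<kappa> w (\<lambda>t. of_real \<kappa> * (cis (real l * t + 2 * \<mu> * sin t) * cnj (w t)))"
    unfolding w_def by (rule spinor_heun[OF f E])
  have wper: "w (t + 2 * pi) = w t" for t unfolding w_def by (rule spinor_periodic[OF f E cos0 per even])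
  obtain C where C: "\<And>n. norm (circle_coeff w (1 * int n)) \<le> C * (1/2) ^ n"
    using heun_coeff_decay[OF w wper \<mu>, of 1] by auto
  define a where "a n = circle_coeff w (int n) / of_real (2 * pi)" for n
  have a: "norm (a n) \<le> C * (1/2) ^ n" for n
  proof -
    have "norm (a n) = norm (circle_coeff w (int n)) / (2 * pi)"
      unfolding a_def by (simp add: norm_divide norm_mult)
    also have "\<dots> \<le> norm (circle_coeff w (int n)) / 1"
      using pi_gt3 by (intro divide_left_mono) auto
    also have "\<dots> \<le> C * (1/2) ^ n" using C[of n] by simp
    finally show ?thesis .
  qed
  have pc: "continuous_on UNIV (\<lambda>t. power_sum a (cis t))"
    by (rule continuous_on_compose2[OF holomorphic_on_imp_continuous_on[OF power_sum_holomorphic[OF a]]])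
      (auto intro!: continuous_intros)
  have wc: "continuous_on S w" for S by (rule heun_solution_continuous_on[OF w])
  have "w t - power_sum a (cis t) = 0" for t
  proof (rule circle_coeff_unique)
    show "continuous_on UNIV (\<lambda>t. w t - power_sum a (cis t))" by (intro continuous_intros wc pc)
    show "w (t + 2 * pi) - power_sum a (cis (t + 2 * pi)) = w t - power_sum a (cis t)" for t
      by (simp add: wper cis_mult[symmetric])
    show "circle_coeff (\<lambda>t. w t - power_sum a (cis t)) n = 0" for n
    proof -
      have "circle_coeff w n = (if 0 \<le> n then of_real (2 * pi) * a (nat n) else 0)"
        using negative_modes_vanish[OF f E cos0 per even \<kappa> \<mu> open_orbit, of n] by (auto simp: a_def w_def)
      then show ?thesis
        using circle_coeff_diff[OF wc continuous_on_subset[OF pc]] circle_coeff_power_sum[OF a] by simp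
    qed
  qed
  with a show thesis by (intro that[of a C]) (auto simp: w_def)
qed

text \<open>The integral is, up to a factor, the area \<open>\<Sum> n \<bar>a\<^sub>n\<bar>\<^sup>2\<close> swept by a function holomorphic in
  the disc.\<close>
lemma variation_integral_pos:
  assumes f: "torus_solution (2 * \<kappa>) (real l) (2 * \<mu>) f" and E: "variation_weight (2 * \<kappa>) f E"
    and cos0: "cos (f 0) = 0" and per: "f (2 * pi) = f 0 + 2 * pi * of_int s" and even: "even (int l - s)"
    and \<kappa>: "\<kappa> > 0" and \<mu>: "\<mu> \<noteq> 0"
    and open_orbit: "\<And>k::int. torus_flow (2 * \<kappa>) (real l) (2 * \<mu>) x (2 * pi) \<noteq> x + 2 * pi * of_int k"
  shows "integral {0..2*pi} (\<lambda>t. E t * sin (f t)) > 0"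
proof -
  define w where "w = spinor l \<mu> E f"
  define w' where "w' t = of_real \<kappa> * (cis (real l * t + 2 * \<mu> * sin t) * cnj (w t))" for t
  have w: "(w has_vector_derivative w' t) (at t)" for t
    unfolding w_def w'_def by (rule spinor_derivative[OF f E])
  have wc: "continuous_on S w" for S using w by (rule has_vector_derivative_continuous_on)
  have w'c: "continuous_on S w'" for S unfolding w'_def by (intro continuous_intros wc)
  have wper: "w (t + 2 * pi) = w t" for t unfolding w_def by (rule spinor_periodic[OF f E cos0 per even])
  have Epos: "E t > 0" for t using E by (auto simp: variation_weight_def)
  have wnz: "w t \<noteq> 0" for t using Epos[of t] by (simp add: w_def spinor_def)
  obtain a C where a: "\<And>n. norm (a n) \<le> C * (1/2) ^ n" and wa: "\<And>t. w t = power_sum a (cis t)"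
    unfolding w_def by (rule spinor_power_sum[OF f E cos0 per even \<kappa> \<mu> open_orbit]) blast
  \<comment> \<open>In effect \<open>w' = \<kappa> cis f w\<close>, so the area form of
    \<open>w\<close> is the integrand of the parameter derivative.\<close>
  have im: "Im (cnj (w t) * w' t) = \<kappa> * (E t * sin (f t))" for t
  proof -
    let ?g = "(real l * t + 2 * \<mu> * sin t - f t) / 2" and ?p = "real l * t + 2 * \<mu> * sin t"
    have "cnj (w t) * w' t = of_real \<kappa> * (of_real (sqrt (E t)) * of_real (sqrt (E t))) * (cis (- ?g) * (cis ?p * cis (- ?g)))"
      unfolding w'_def w_def spinor_def by (simp add: cis_cnj)
    also have "of_real (sqrt (E t)) * of_real (sqrt (E t)) = complex_of_real (E t)"
      using Epos[of t] by (simp add: of_real_mult[symmetric] del: of_real_mult)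
    also have "cis (- ?g) * (cis ?p * cis (- ?g)) = cis (f t)"
      unfolding cis_mult by (simp add: field_simps)
    finally show ?thesis by simp
  qed
  have "(\<lambda>n. Im (2 * pi * \<i> * of_nat n * of_real ((cmod (a n))\<^sup>2))) sums Im (integral {0..2*pi} (\<lambda>t. cnj (w t) * w' t))"
    using area_sums[OF a w w'c _ wa] wper[of 0] by (intro sums_Im) simp
  also have "Im (integral {0..2*pi} (\<lambda>t. cnj (w t) * w' t)) = integral {0..2*pi} (\<lambda>t. Im (cnj (w t) * w' t))"
  proof -
    have "(\<lambda>t. cnj (w t) * w' t) integrable_on {0..2*pi}"
      by (intro integrable_continuous_real continuous_intros wc w'c)
    from integral_linear[OF this bounded_linear_Im] show ?thesis by (simp add: o_def)
  qed
  also have "\<dots> = \<kappa> * integral {0..2*pi} (\<lambda>t. E t * sin (f t))" unfolding im by simp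
  finally have sums: "(\<lambda>n. 2 * pi * real n * (cmod (a n))\<^sup>2) sums (\<kappa> * integral {0..2*pi} (\<lambda>t. E t * sin (f t)))"
    by simp
  \<comment> \<open>All terms are nonnegative; strictness needs a nonconstant \<open>w\<close>, and
    \<open>w'\<close> has no zero.\<close>
  have "\<exists>n. n \<noteq> 0 \<and> a n \<noteq> 0"
  proof (rule ccontr)
    assume "\<not> (\<exists>n. n \<noteq> 0 \<and> a n \<noteq> 0)"
    then have a0: "a n = 0" if "n \<noteq> 0" for n using that by blast
    have "w t = a 0" for t
    proof -
      have "(\<lambda>n. a n * cis t ^ n) sums (a 0 * cis t ^ 0)"
        using sums_finite[of "{0}" "\<lambda>n. a n * cis t ^ n"] a0 by simp
      then show ?thesis using wa[of t] by (simp add: power_sum_def sums_iff)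
    qed
    then have "w = (\<lambda>t. a 0)" by blast
    then have "(w has_vector_derivative 0) (at 0)" by simp
    from vector_derivative_unique_at[OF this w] have "w' 0 = 0" by simp
    then show False using wnz[of 0] \<kappa> by (simp add: w'_def)
  qed
  then obtain m where m: "m \<noteq> 0" "a m \<noteq> 0" by blast
  have "0 < (\<Sum>n. 2 * pi * real n * (cmod (a n))\<^sup>2)"
    using sums m by (intro suminf_pos2[of _ m]) (auto simp: sums_iff)
  then have "0 < \<kappa> * integral {0..2*pi} (\<lambda>t. E t * sin (f t))" using sums by (simp add: sums_iff)
  then show ?thesis using \<kappa> by (simp add: zero_less_mult_iff)
qed

text \<open>Eigenvalues of the matrix with 1, ..., \<open>l - 1\<close> above the diagonal plus
  \<open>c\<close> on the antidiagonal. The convention \<open>q l = 0\<close> gives the last row the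
  form of the others.\<close>

definition pencil_spectrum :: "nat \<Rightarrow> complex \<Rightarrow> complex set" where
  "pencil_spectrum l c = {k. \<exists>q. (\<exists>m<l. q m \<noteq> 0) \<and> q l = 0 \<and>
      (\<forall>m<l. of_nat (Suc m) * q (Suc m) + c * q (l - 1 - m) = k * q m)}"

lemma finite_pencil_spectrum: "finite (pencil_spectrum l c)"
proof -
  define A where "A = Matrix.mat l l (\<lambda>(i, j). (if j = Suc i then of_nat (Suc i) else 0) + (if j = l - 1 - i then c else 0))"
  have A: "A \<in> carrier_mat l l" by (simp add: A_def)
  have "pencil_spectrum l c \<subseteq> {k. poly (char_poly A) k = 0}"
    unfolding pencil_spectrum_def
  proof (safe)
    fix k and q :: "nat \<Rightarrow> complex" and m0
    assume m0: "m0 < l" "q m0 \<noteq> 0" and ql: "q l = 0"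
      and q: "\<forall>m<l. of_nat (Suc m) * q (Suc m) + c * q (l - 1 - m) = k * q m"
    have "eigenvector A (Matrix.vec l q) k"
      unfolding eigenvector_def
    proof (intro conjI)
      show "Matrix.vec l q \<in> carrier_vec (dim_row A)" by (simp add: A_def)
      show "Matrix.vec l q \<noteq> 0\<^sub>v (dim_row A)"
      proof
        assume "Matrix.vec l q = 0\<^sub>v (dim_row A)"
        then have "vec_index (Matrix.vec l q) m0 = vec_index (0\<^sub>v l) m0" by (simp add: A_def)
        with m0 show False by simp
      qed
      show "A *\<^sub>v Matrix.vec l q = k \<cdot>\<^sub>v Matrix.vec l q"
      proof (rule eq_vecI)
        fix i assume "i < dim_vec (k \<cdot>\<^sub>v Matrix.vec l q)"
        then have i: "i < l" by simp
        have "vec_index (A *\<^sub>v Matrix.vec l q) i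
            = (\<Sum>j\<in>{0..<l}. (if j = Suc i then of_nat (Suc i) * q j else 0) + (if j = l - 1 - i then c * q j else 0))"
          using i by (auto simp: A_def scalar_prod_def distrib_right intro!: sum.cong)
        also have "\<dots> = of_nat (Suc i) * q (Suc i) + c * q (l - 1 - i)"
        proof -
          have "q (Suc i) = 0" if "\<not> Suc i < l"
          proof -
            have "Suc i = l" using i that by simp
            then show ?thesis using ql by simp
          qed
          then show ?thesis using i by (auto simp: sum.distrib)
        qed
        finally show "vec_index (A *\<^sub>v Matrix.vec l q) i = vec_index (k \<cdot>\<^sub>v Matrix.vec l q) i" using q i by simp
      qed (simp add: A_def)
    qed
    then show "poly (char_poly A) k = 0"
      using eigenvalue_root_char_poly[OF A] by (auto simp: eigenvalue_def)
  qed
  moreover have "char_poly A \<noteq> 0" using degree_monic_char_poly[OF A] by auto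
  ultimately show ?thesis using finite_subset poly_roots_finite by blast
qed

text \<open>\<open>exp (- \<mu> z) w\<close> is a polynomial of degree below \<open>l\<close> (Buchstaber and Tertychnyi). Its coefficients \<open>p\<close>
  solve a real-linear eigenvalue problem for \<open>- \<mu>\<close>, which \<open>p \<plusminus> \<i> cnj p\<close> turns into two complex-linear ones.\<close>
lemma simple_point_spectrum:
  assumes f: "torus_solution (2 * \<kappa>) (real l) (2 * \<mu>) f" and E: "variation_weight (2 * \<kappa>) f E"
    and cos0: "cos (f 0) = 0" and per: "f (2 * pi) = f 0 + 2 * pi * of_int s" and even: "even (int l - s)"
    and \<kappa>: "\<kappa> > 0" and \<mu>: "\<mu> \<noteq> 0"
    and open_orbit: "\<And>k::int. torus_flow (2 * \<kappa>) (real l) (2 * \<mu>) x (2 * pi) \<noteq> x + 2 * pi * of_int k"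
  shows "- of_real \<mu> \<in> pencil_spectrum l (of_real \<kappa>) \<union> pencil_spectrum l (- of_real \<kappa>)"
proof -
  define w where "w = spinor l \<mu> E f"
  have w: "(w has_vector_derivative of_real \<kappa> * (cis (real l * t + 2 * \<mu> * sin t) * cnj (w t))) (at t)" for t
    unfolding w_def by (rule spinor_derivative[OF f E])
  have wper: "w (t + 2 * pi) = w t" for t unfolding w_def by (rule spinor_periodic[OF f E cos0 per even])
  obtain a C where a: "\<And>n. norm (a n) \<le> C * (1/2) ^ n" and wa: "\<And>t. w t = power_sum a (cis t)"
    unfolding w_def by (rule spinor_power_sum[OF f E cos0 per even \<kappa> \<mu> open_orbit]) blast
  \<comment> \<open>This factor cancels one exponential of the phase, and its conjugate takes up the
    other. The equation for \<open>p\<close> has trigonometric coefficients, and its recursion links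
    only \<open>n\<close>, \<open>n - 1\<close> and \<open>l - n\<close>.\<close>
  define p where "p t = exp (- of_real \<mu> * cis t) * w t" for t
  define p' where "p' t = (- \<i> * of_real \<mu>) * (cis t * p t) + of_real \<kappa> * (cis (of_int (int l) * t) * cnj (p t))" for t
  have p: "(p has_vector_derivative p' t) (at t)" for t
  proof -
    have "((\<lambda>t. exp (- of_real \<mu> * cis t)) has_vector_derivative
        \<i> * (cis t * deriv (\<lambda>z. exp (- of_real \<mu> * z)) (cis t))) (at t)"
      by (rule has_vector_derivative_circle_holomorphic[of _ 2]) (auto intro!: holomorphic_intros)
    moreover have "deriv (\<lambda>z. exp (- of_real \<mu> * z)) (cis t) = - of_real \<mu> * exp (- of_real \<mu> * cis t)"
      by (rule DERIV_imp_deriv) (auto intro!: derivative_eq_intros)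
    ultimately have e: "((\<lambda>t. exp (- of_real \<mu> * cis t)) has_vector_derivative
        \<i> * (cis t * (- of_real \<mu> * exp (- of_real \<mu> * cis t)))) (at t)" by simp
    have e2: "exp (- of_real \<mu> * cis t) * (of_real \<kappa> * (cis (real l * t + 2 * \<mu> * sin t) * cnj (w t)))
       = of_real \<kappa> * (cis (of_int (int l) * t) * cnj (p t))"
    proof -
      have "exp (- of_real \<mu> * cis t) * exp (of_real \<mu> * cis t) = 1" by (simp add: exp_add[symmetric])
      moreover have "cnj (p t) = exp (- of_real \<mu> * cis (- t)) * cnj (w t)"
        using cnj_exp_cis[of "- \<mu>" t] by (simp add: p_def)
      moreover have "exp (- of_real \<mu> * cis t) * (of_real \<kappa> * (cis (real l * t + 2 * \<mu> * sin t) * cnj (w t)))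
         = (exp (- of_real \<mu> * cis t) * exp (of_real \<mu> * cis t)) * (of_real \<kappa> * (cis t ^ l * (exp (- of_real \<mu> * cis (- t)) * cnj (w t))))"
        unfolding cis_phase_factor by (simp only: mult_ac)
      ultimately show ?thesis by (simp add: Complex.DeMoivre)
    qed
    have "p' t = exp (- of_real \<mu> * cis t) * (of_real \<kappa> * (cis (real l * t + 2 * \<mu> * sin t) * cnj (w t)))
        + \<i> * (cis t * (- of_real \<mu> * exp (- of_real \<mu> * cis t))) * w t"
      unfolding e2 p'_def by (simp add: p_def)
    then show ?thesis unfolding p_def[abs_def] using has_vector_derivative_mult[OF e w] by simp
  qed
  have pc: "continuous_on S p" for S using p by (rule has_vector_derivative_continuous_on)
  have p'c: "continuous_on S p'" for S unfolding p'_def by (intro continuous_intros pc)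
  have pper: "p (t + 2 * pi) = p t" for t by (simp add: p_def wper cis_mult[symmetric])
  let ?c = "circle_coeff p"
  have rec: "of_int n * ?c n + of_real \<mu> * ?c (n - 1) = - \<i> * of_real \<kappa> * cnj (?c (int l - n))" for n
  proof -
    have "circle_coeff p' n = (- \<i> * of_real \<mu>) * ?c (n - 1) + of_real \<kappa> * circle_coeff (\<lambda>t. cnj (p t)) (n - int l)"
      unfolding p'_def
      by (subst circle_coeff_add) (auto intro!: continuous_intros pc simp only: circle_coeff_cmult circle_coeff_shift circle_coeff_shift_1)
    moreover have "circle_coeff p' n = \<i> * of_int n * ?c n"
      using circle_coeff_deriv[OF p p'c] pper[of 0] by simp
    ultimately have "\<i> * of_int n * ?c n = (- \<i> * of_real \<mu>) * ?c (n - 1) + of_real \<kappa> * cnj (?c (int l - n))"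
      by (simp add: circle_coeff_cnj)
    then have "(- \<i>) * (\<i> * of_int n * ?c n) = (- \<i>) * ((- \<i> * of_real \<mu>) * ?c (n - 1) + of_real \<kappa> * cnj (?c (int l - n)))"
      by simp
    then show ?thesis by (simp add: algebra_simps)
  qed
  have neg: "?c n = 0" if "n < 0" for n
  proof -
    have "circle_coeff (\<lambda>t. exp (- of_real \<mu> * cis t) * power_sum a (cis t)) n = 0"
      by (rule circle_coeff_holomorphic[of "\<lambda>z. exp (- of_real \<mu> * z) * power_sum a z" 2])
        (use that in \<open>auto intro!: holomorphic_intros power_sum_holomorphic[OF a]\<close>)
    then show ?thesis by (simp add: p_def[abs_def] wa)
  qed
  \<comment> \<open>The recursion at \<open>l - n\<close> has \<open>n\<close> on its right side. On
    its left stand negative modes only, except for the zero mode when \<open>n = l\<close>, which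
    has the factor 0.\<close>
  have large: "?c n = 0" if "n \<ge> int l" for n
  proof -
    have A: "of_int (int l - n) * ?c (int l - n) = 0"
      using neg[of "int l - n"] that by (cases "n = int l") auto
    have B: "?c (int l - n - 1) = 0" using neg[of "int l - n - 1"] that by auto
    have "- \<i> * of_real \<kappa> * cnj (?c (int l - (int l - n))) = 0"
      unfolding rec[symmetric] A B by simp
    then show ?thesis using \<kappa> by simp
  qed
  \<comment> \<open>All other modes are zero already; if these were too, \<open>p\<close> and with
    it \<open>w\<close> would vanish.\<close>
  have "\<exists>m<l. ?c (int m) \<noteq> 0"
  proof (rule ccontr)
    assume *: "\<not> (\<exists>m<l. ?c (int m) \<noteq> 0)"
    have "?c n = 0" for n
    proof -
      consider "n < 0" | "n \<ge> int l" | "nat n < l" "n = int (nat n)" by linarith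
      then show ?thesis using neg large * by cases metis+
    qed
    from circle_coeff_unique[OF pc pper this, of 0] have "w 0 = 0" by (simp add: p_def)
    then show False using E by (auto simp: w_def spinor_def variation_weight_def)
  qed
  then obtain m0 where m0: "m0 < l" "?c (int m0) \<noteq> 0" by blast
  define q where "q \<epsilon> m = ?c (int m) + \<epsilon> * \<i> * cnj (?c (int m))" for \<epsilon> :: complex and m
  have mem: "- of_real \<mu> \<in> pencil_spectrum l (\<epsilon> * of_real \<kappa>)" if \<epsilon>: "\<epsilon> = 1 \<or> \<epsilon> = - 1" and "q \<epsilon> m0 \<noteq> 0" for \<epsilon>
    unfolding pencil_spectrum_def
  proof (intro CollectI exI[of _ "q \<epsilon>"] conjI allI impI)
    show "\<exists>m<l. q \<epsilon> m \<noteq> 0" using that m0 by blast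
    show "q \<epsilon> l = 0" using large[of "int l"] by (simp add: q_def)
    fix m assume m: "m < l"
    have lm: "int l - int (Suc m) = int (l - 1 - m)" using m by auto
    have r: "of_nat (Suc m) * ?c (int (Suc m)) + of_real \<mu> * ?c (int m) = - \<i> * of_real \<kappa> * cnj (?c (int (l - 1 - m)))"
      using rec[of "int (Suc m)"] unfolding lm by simp
    have r': "of_nat (Suc m) * cnj (?c (int (Suc m))) + of_real \<mu> * cnj (?c (int m)) = \<i> * of_real \<kappa> * ?c (int (l - 1 - m))"
      using arg_cong[OF r, of cnj] by simp
    have "of_nat (Suc m) * q \<epsilon> (Suc m) + of_real \<mu> * q \<epsilon> m
       = (of_nat (Suc m) * ?c (int (Suc m)) + of_real \<mu> * ?c (int m))
       + \<epsilon> * \<i> * (of_nat (Suc m) * cnj (?c (int (Suc m))) + of_real \<mu> * cnj (?c (int m)))"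
      unfolding q_def by (simp only: distrib_left mult_ac add_ac)
    also have "\<dots> = - (\<epsilon> * of_real \<kappa>) * q \<epsilon> (l - 1 - m)"
      unfolding r r' q_def using \<epsilon> by (auto simp: algebra_simps)
    finally have fin: "of_nat (Suc m) * q \<epsilon> (Suc m) + of_real \<mu> * q \<epsilon> m = - (\<epsilon> * of_real \<kappa>) * q \<epsilon> (l - 1 - m)" .
    have "X + c * W = - M * V" if "X + M * V = - c * W" for X M V c W :: complex
      using that by (simp add: eq_neg_iff_add_eq_0 ac_simps)
    from this[OF fin] show "of_nat (Suc m) * q \<epsilon> (Suc m) + \<epsilon> * of_real \<kappa> * q \<epsilon> (l - 1 - m) = - of_real \<mu> * q \<epsilon> m" .
  qed
  \<comment> \<open>One of the two combinations may vanish identically, but not both; this is why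
    two spectra occur.\<close>
  have "q 1 m0 + q (- 1) m0 = 2 * ?c (int m0)" by (simp add: q_def)
  then have "q 1 m0 \<noteq> 0 \<or> q (- 1) m0 \<noteq> 0" using m0 by auto
  then show ?thesis using mem[of 1] mem[of "- 1"] by auto
qed

section \<open>Tangencies with the axis\<close>

lemma open_contains_rectangle:
  fixes V :: "(real \<times> real) set"
  assumes "open V" "(p, q) \<in> V"
  obtains d where "d > 0" "\<And>x y. \<bar>x - p\<bar> < d \<Longrightarrow> \<bar>y - q\<bar> < d \<Longrightarrow> (x, y) \<in> V"
proof -
  obtain X Y where XY: "open X" "open Y" "p \<in> X" "q \<in> Y" "X \<times> Y \<subseteq> V"
    using open_prod_elim[OF assms] by (metis mem_Sigma_iff)
  obtain d1 d2 where d: "d1 > 0" "ball p d1 \<subseteq> X" "d2 > 0" "ball q d2 \<subseteq> Y"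
    using XY(1-4) by (meson openE)
  show thesis
  proof (rule that[of "min d1 d2"])
    fix x y assume "\<bar>x - p\<bar> < min d1 d2" "\<bar>y - q\<bar> < min d1 d2"
    then have "x \<in> ball p d1" "y \<in> ball q d2" by (auto simp: dist_real_def abs_minus_commute)
    then show "(x, y) \<in> V" using d XY(5) by blast
  qed (use d in auto)
qed

text \<open>The sine of half the displacement vanishes exactly at whole numbers of turns, so one
  continuous function excludes all \<open>k\<close> at once.\<close>

lemma open_orbit_nearby:
  assumes "\<And>k::int. torus_flow a b c0 x (2 * pi) \<noteq> x + 2 * pi * of_int k"
  obtains \<eta> where "\<eta> > 0"
    "\<And>c k. \<bar>c - c0\<bar> < \<eta> \<Longrightarrow> torus_flow a b c x (2 * pi) \<noteq> x + 2 * pi * of_int (k::int)"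
proof -
  define g where "g c = sin ((torus_flow a b c x (2 * pi) - x) / 2)" for c
  have g0: "g c = 0 \<longleftrightarrow> (\<exists>k::int. torus_flow a b c x (2 * pi) = x + 2 * pi * of_int k)" for c
  proof -
    have "g c = 0 \<longleftrightarrow> (\<exists>k::int. (torus_flow a b c x (2 * pi) - x) / 2 = of_int k * pi)"
      by (simp add: g_def sin_zero_iff_int2)
    also have "\<dots> \<longleftrightarrow> (\<exists>k::int. torus_flow a b c x (2 * pi) = x + 2 * pi * of_int k)"
      by (intro ex_cong1) (auto simp: field_simps)
    finally show ?thesis .
  qed
  have "continuous_on UNIV g"
    unfolding g_def by (intro continuous_intros continuous_on_torus_flow) auto
  then have "open (g -` (- {0}))" by (intro open_vimage) auto
  moreover have "c0 \<in> g -` (- {0})" using assms g0 by auto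
  ultimately obtain \<eta> where "\<eta> > 0" "ball c0 \<eta> \<subseteq> g -` (- {0})" by (meson openE)
  then show thesis
    using g0 by (intro that[of \<eta>]) (auto simp: dist_real_def abs_minus_commute subset_iff)
qed

theorem theorem1p30:
  fixes l :: nat and s :: int and \<sigma> :: bool and \<omega>0 B0 A0 :: real
  assumes "s \<noteq> int l"
    and "left_moving_tangency \<omega>0 l s \<sigma> B0 A0"
  shows "\<not> gen_simple_intersection \<omega>0 (int l) B0 A0"
proof
  assume gsi: "gen_simple_intersection \<omega>0 (int l) B0 A0"
  define x0 where "x0 = (if \<sigma> then pi / 2 else - (pi / 2))"
  obtain \<mu> where \<omega>0: "\<omega>0 > 0" and \<mu>: "\<mu> > 0" "B0 = real l * \<omega>0" "A0 = 2 * \<mu> * \<omega>0"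
    and mem: "(B0, A0) \<in> bdry_pm \<omega>0 s \<sigma>" and germ: "germ_right (bdry_pm \<omega>0 s \<sigma>) (B0, A0)"
    using assms(2) unfolding left_moving_tangency_def by blast
  obtain U \<epsilon> where U: "open U" "(B0, A0) \<in> U" and \<epsilon>: "\<epsilon> > 0"
    and empty: "\<And>\<omega>. \<omega>0 < \<omega> \<Longrightarrow> \<omega> < \<omega>0 + \<epsilon> \<Longrightarrow> bdry_pm \<omega> s \<sigma> \<inter> axis \<omega> (int l) \<inter> U = {}"
    using assms(2) unfolding left_moving_tangency_def by blast
  obtain \<delta> where \<delta>: "\<delta> > 0" and right: "\<And>q. q \<in> bdry_pm \<omega>0 s \<sigma> \<Longrightarrow> dist q (B0, A0) < \<delta> \<Longrightarrow> fst q \<ge> B0"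
    using germ unfolding germ_right_def by auto
  define a0 where "a0 = 1 / \<omega>0"
  define c0 where "c0 = 2 * \<mu>"
  have a0: "a0 > 0" and c0: "c0 > 0" using \<omega>0 \<mu>(1) by (simp_all add: a0_def c0_def)
  \<comment> \<open>The displacement over one period, reduced by the prescribed \<open>s\<close>
    turns; in the coordinates \<open>b\<close>, \<open>c\<close> its zero set is the boundary
    curve.\<close>
  define F where "F a b c = torus_flow a b c x0 (2 * pi) - (x0 + 2 * pi * of_int s)" for a b c
  have F_mem: "(b * \<omega>, c * \<omega>) \<in> bdry_pm \<omega> s \<sigma> \<longleftrightarrow> F (1 / \<omega>) b c = 0" if "\<omega> > 0" for \<omega> b c
    using that by (simp add: mem_bdry_pm_iff F_def x0_def)
  have F0: "F a0 (real l) c0 = 0"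
    using F_mem[OF \<omega>0, of "real l" c0] mem by (simp add: \<mu> a0_def c0_def)
  have F_cont: "continuous_on S (\<lambda>z. F (A z) (B z) (C z))"
    if "continuous_on S A" "continuous_on S B" "continuous_on S C" for A B C :: "real \<Rightarrow> real" and S
    unfolding F_def by (intro continuous_intros continuous_on_torus_flow that) auto
  have cos0: "cos x0 = 0" by (simp add: x0_def)
  \<comment> \<open>The parity in the definition of a generalized simple intersection is stated for
    some phase-lock area; the rotation number identifies it with the given one.\<close>
  have even: "even (int l - s)"
  proof -
    obtain s' where s': "s' mod 2 = int l mod 2" "(B0, A0) \<in> bdry \<omega>0 s'"
      using gsi unfolding gen_simple_intersection_def by blast
    have "rot \<omega>0 B0 A0 = of_int s'" "rot \<omega>0 B0 A0 = of_int s"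
      using s'(2) mem by (auto simp: bdry_def bdry_pm_def phase_lock_def)
    then have "s' = s" by simp
    then show ?thesis using s'(1) by presburger
  qed
  obtain x where x: "\<And>k::int. torus_flow a0 (real l) c0 x (2 * pi) \<noteq> x + 2 * pi * of_int k"
  proof -
    have "\<not> constriction \<omega>0 B0 A0" using gsi by (simp add: gen_simple_intersection_def)
    moreover have "(B0, A0) \<in> phase_lock \<omega>0 s" using mem by (simp add: bdry_pm_def)
    moreover have "A0 \<noteq> 0" using \<mu> \<omega>0 by simp
    ultimately obtain x where "\<not> fixes_mod (poincare \<omega>0 B0 A0) x" unfolding constriction_def by blast
    then show thesis
      using \<omega>0 by (intro that[of x]) (auto simp: fixes_mod_def poincare_def sol_eq_torus_flow \<mu> a0_def c0_def)
  qed
  \<comment> \<open>The spectral lemma will be applied at every zero near \<open>c0\<close>, so the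
    orbit of \<open>x\<close> has to stay open for all these parameters.\<close>
  obtain \<eta>1 where \<eta>1: "\<eta>1 > 0"
    and x': "\<And>c k. \<bar>c - c0\<bar> < \<eta>1 \<Longrightarrow> torus_flow a0 (real l) c x (2 * pi) \<noteq> x + 2 * pi * of_int (k::int)"
    using open_orbit_nearby[OF x] by metis
  define f where "f c = torus_flow a0 (real l) c x0" for c
  have f: "torus_solution (2 * (a0 / 2)) (real l) (2 * (c / 2)) (f c)" and f0: "f c 0 = x0" for c
    by (simp_all add: f_def torus_flow_solution)
  have "\<exists>E. variation_weight (2 * (a0 / 2)) (f c) E" for c
    by (rule variation_weight_exists[OF torus_solution_continuous_on[OF f]]) blast
  then obtain E where E: "\<And>c. variation_weight (2 * (a0 / 2)) (f c) (E c)" by metis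
  have fper: "f c (2 * pi) = f c 0 + 2 * pi * of_int s" if "F a0 (real l) c = 0" for c
    using that by (simp add: F_def f_def)

  have up: "\<exists>e>0. \<forall>a'. a0 - e < a' \<and> a' < a0 \<longrightarrow> F a' (real l) c0 > 0"
  proof -
    have cont: "continuous_on UNIV (\<lambda>t. E c0 t * sin (f c0 t))"
      by (intro continuous_intros variation_weight_continuous_on[OF E] torus_solution_continuous_on[OF f])
    obtain S where S: "S 0 = 0" "\<And>t. (S has_real_derivative E c0 t * sin (f c0 t)) (at t)"
      by (rule antiderivative_UNIV[OF cont]) blast
    have "((\<lambda>t. E c0 t * sin (f c0 t)) has_integral S (2 * pi) - S 0) {0..2*pi}"
      by (rule fundamental_theorem_of_calculus)
        (use S(2) in \<open>auto simp: has_real_derivative_iff_has_vector_derivative intro: has_vector_derivative_at_within\<close>)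
    moreover have "integral {0..2*pi} (\<lambda>t. E c0 t * sin (f c0 t)) > 0"
      by (rule variation_integral_pos[where x = x, OF f E _ fper[OF F0] even])
        (use a0 c0 x f0 cos0 in auto)
    ultimately have "S (2 * pi) > 0" using S(1) by (simp add: integral_unique)
    from flow_increases_as_a_decreases[OF f E _ S this]
    have "\<exists>e>0. \<forall>a'. a0 - e < a' \<and> a' < a0 \<longrightarrow> torus_flow a' (real l) c0 x0 (2 * pi) > f c0 (2 * pi)"
      by (simp add: f0)
    then show ?thesis using fper[OF F0] by (auto simp: F_def f0)
  qed

  \<comment> \<open>A positive value on the axis and a negative one at some \<open>b1 < l\<close>
    with the same \<open>c\<close> would enclose a boundary point to the left of the axis, against
    the position of the germ.\<close>
  have below: "\<exists>\<eta>>0. \<forall>c. \<bar>c - c0\<bar> < \<eta> \<longrightarrow> F a0 (real l) c \<le> 0"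
  proof -
    let ?V = "(\<lambda>p. (fst p * \<omega>0, snd p * \<omega>0)) -` ball (B0, A0) \<delta>"
    have "open ?V" by (intro open_vimage open_ball continuous_intros)
    moreover have "(real l, c0) \<in> ?V" using \<delta> by (simp add: \<mu> c0_def)
    ultimately obtain d where d: "d > 0"
      and dV: "\<And>b c. \<bar>b - real l\<bar> < d \<Longrightarrow> \<bar>c - c0\<bar> < d \<Longrightarrow> (b, c) \<in> ?V"
      by (rule open_contains_rectangle) blast
    obtain e where e: "e > 0" "\<And>b'. real l - e < b' \<Longrightarrow> b' < real l \<Longrightarrow> torus_flow a0 b' c0 x0 (2 * pi) < f c0 (2 * pi)"
      using flow_decreases_as_b_decreases[OF f, of "2 * pi" c0] by (auto simp: f0)
    \<comment> \<open>Near enough to \<open>l\<close> both for the strict decrease in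
      \<open>b\<close> and for the rectangle inside \<open>?V\<close>.\<close>
    define b1 where "b1 = real l - min e d / 2"
    have b1: "real l - e < b1" "b1 < real l" "real l - d < b1" using e(1) d by (auto simp: b1_def min_def)
    have "F a0 b1 c0 < 0" using e(2)[OF b1(1,2)] fper[OF F0] by (simp add: F_def f0)
    moreover have "open ((\<lambda>c. F a0 b1 c) -` {..<0})"
      by (intro open_vimage open_lessThan F_cont continuous_intros)
    ultimately obtain \<eta> where \<eta>: "\<eta> > 0" "ball c0 \<eta> \<subseteq> (\<lambda>c. F a0 b1 c) -` {..<0}"
      by (metis lessThan_iff openE vimage_eq)
    show ?thesis
    proof (intro exI[of _ "min \<eta> d"] conjI allI impI)
      fix c assume c: "\<bar>c - c0\<bar> < min \<eta> d"
      show "F a0 (real l) c \<le> 0"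
      proof (rule ccontr)
        assume pos: "\<not> F a0 (real l) c \<le> 0"
        have "c \<in> ball c0 \<eta>" using c by (simp add: dist_real_def abs_minus_commute)
        then have "F a0 b1 c < 0" using \<eta>(2) by auto
        then have "\<exists>b\<ge>b1. b \<le> real l \<and> F a0 b c = 0"
          using pos b1 by (intro IVT') (auto intro!: F_cont continuous_intros)
        then obtain b where b: "b1 \<le> b" "b \<le> real l" "F a0 b c = 0" by blast
        then have "b < real l" using pos by (cases "b = real l") auto
        have "(b, c) \<in> ?V" using b b1 c by (intro dV) auto
        moreover have "(b * \<omega>0, c * \<omega>0) \<in> bdry_pm \<omega>0 s \<sigma>" using b(3) F_mem[OF \<omega>0] by (simp add: a0_def)
        ultimately have "b * \<omega>0 \<ge> B0" using right[of "(b * \<omega>0, c * \<omega>0)"] by (simp add: dist_commute)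
        with \<open>b < real l\<close> \<omega>0 show False by (simp add: \<mu>)
      qed
    qed (use \<eta> d in auto)
  qed
  then obtain \<eta>2 where \<eta>2: "\<eta>2 > 0" and nonpos: "\<And>c. \<bar>c - c0\<bar> < \<eta>2 \<Longrightarrow> F a0 (real l) c \<le> 0" by blast

  \<comment> \<open>In the coordinates \<omega> and \<open>c\<close> the points of all nearby axes
    are \<open>(l \<omega>, c \<omega>)\<close>, so a rectangle controls them uniformly in
    \<omega>.\<close>
  let ?W = "(\<lambda>p. (real l * fst p, snd p * fst p)) -` U"
  have "open ?W" by (intro open_vimage U continuous_intros)
  moreover have "(\<omega>0, c0) \<in> ?W" using U(2) by (simp add: \<mu> c0_def)
  ultimately obtain d where d: "d > 0" and dW: "\<And>\<omega> c. \<bar>\<omega> - \<omega>0\<bar> < d \<Longrightarrow> \<bar>c - c0\<bar> < d \<Longrightarrow> (\<omega>, c) \<in> ?W"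
    by (rule open_contains_rectangle) blast

  \<comment> \<open>\<open>\<eta>1\<close> keeps the orbit of \<open>x\<close> open,
    \<open>\<eta>2\<close> keeps the displacement nonpositive, \<open>d\<close> keeps the points in
    \<open>U\<close>, and \<open>c0\<close> keeps \<open>c\<close> positive as the spectral lemma
    requires.\<close>
  define \<eta> where "\<eta> = min (min \<eta>1 \<eta>2) (min d c0)"
  have \<eta>: "\<eta> > 0" "\<eta> \<le> \<eta>1" "\<eta> \<le> \<eta>2" "\<eta> \<le> d" "\<eta> \<le> c0"
    using \<eta>1 \<eta>2 d c0 by (auto simp: \<eta>_def)
  \<comment> \<open>Otherwise infinitely many numbers \<open>- c / 2\<close> would lie in two finite
    spectra that depend on \<open>l\<close> and \<open>a0\<close> only.\<close>
  have "\<exists>c. \<bar>c - c0\<bar> < \<eta> \<and> F a0 (real l) c \<noteq> 0"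
  proof (rule ccontr)
    assume all0: "\<not> ?thesis"
    let ?S = "pencil_spectrum l (of_real (a0 / 2)) \<union> pencil_spectrum l (- of_real (a0 / 2))"
    have "(\<lambda>c. - complex_of_real (c / 2)) ` {c0 - \<eta><..<c0 + \<eta>} \<subseteq> ?S"
    proof (rule image_subsetI)
      fix c assume "c \<in> {c0 - \<eta><..<c0 + \<eta>}"
      then have c: "\<bar>c - c0\<bar> < \<eta>" by auto
      then have "F a0 (real l) c = 0" using all0 by blast
      then show "- complex_of_real (c / 2) \<in> ?S"
        by (intro simple_point_spectrum[where x = x, OF f E _ fper even])
          (use a0 c \<eta> x'[of c] f0 cos0 in auto)
    qed
    then have "finite ((\<lambda>c. - complex_of_real (c / 2)) ` {c0 - \<eta><..<c0 + \<eta>})"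
      by (rule finite_subset) (simp add: finite_pencil_spectrum)
    then have "finite {c0 - \<eta><..<c0 + \<eta>}" by (rule finite_imageD) (auto simp: inj_on_def)
    then show False using infinite_Ioo[of "c0 - \<eta>" "c0 + \<eta>"] \<eta>(1) by simp
  qed
  then obtain c1 where c1: "\<bar>c1 - c0\<bar> < \<eta>" "F a0 (real l) c1 < 0"
    using nonpos \<eta> by (metis less_le_trans order.not_eq_order_implies_strict)

  obtain e where e: "e > 0" "\<And>a'. a0 - e < a' \<Longrightarrow> a' < a0 \<Longrightarrow> F a' (real l) c0 > 0" using up by blast
  have lim: "((\<lambda>\<omega>. 1 / \<omega>) \<longlongrightarrow> a0) (at_right \<omega>0)"
    unfolding a0_def using \<omega>0 by (intro tendsto_intros) auto
  \<comment> \<open>With \<open>c1\<close> fixed, the negative sign found at \<omega>0 survives for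
    slightly larger \<omega>, while at \<open>c0\<close> the sign becomes positive.\<close>
  have "\<forall>\<^sub>F \<omega> in at_right \<omega>0. F (1 / \<omega>) (real l) c1 < 0"
  proof (rule order_tendstoD(2)[OF _ c1(2)])
    show "((\<lambda>\<omega>. F (1 / \<omega>) (real l) c1) \<longlongrightarrow> F a0 (real l) c1) (at_right \<omega>0)"
      unfolding F_def by (intro tendsto_diff tendsto_const tendsto_torus_flow lim) auto
  qed
  moreover have "\<forall>\<^sub>F \<omega> in at_right \<omega>0. a0 - e < 1 / \<omega>" using order_tendstoD(1)[OF lim] e(1) by simp
  moreover have "\<forall>\<^sub>F \<omega> in at_right \<omega>0. \<omega> \<in> {\<omega>0<..<\<omega>0 + min \<epsilon> d}"
    by (rule eventually_at_right_real) (use \<epsilon> d in simp)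
  ultimately have "\<forall>\<^sub>F \<omega> in at_right \<omega>0. F (1 / \<omega>) (real l) c1 < 0 \<and> a0 - e < 1 / \<omega> \<and> \<omega> \<in> {\<omega>0<..<\<omega>0 + min \<epsilon> d}"
    by eventually_elim auto
  then obtain \<omega> where \<omega>: "F (1 / \<omega>) (real l) c1 < 0" "a0 - e < 1 / \<omega>" "\<omega>0 < \<omega>" "\<omega> < \<omega>0 + \<epsilon>" "\<omega> < \<omega>0 + d"
    using eventually_happens' trivial_limit_at_right_real by fastforce
  have "1 / \<omega> < a0" using \<omega>0 \<omega>(3) by (simp add: a0_def frac_less2)
  with e(2) \<omega>(2) have pos: "F (1 / \<omega>) (real l) c0 > 0" by blast
  \<comment> \<open>\<open>c1\<close> may lie on either side of \<open>c0\<close>; in both cases the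
    zero is no farther from \<open>c0\<close> than \<open>c1\<close>, hence still in
    \<open>U\<close>.\<close>
  have "\<exists>c2. \<bar>c2 - c0\<bar> \<le> \<bar>c1 - c0\<bar> \<and> F (1 / \<omega>) (real l) c2 = 0"
  proof (cases "c1 \<le> c0")
    case True
    then have "\<exists>c2\<ge>c1. c2 \<le> c0 \<and> F (1 / \<omega>) (real l) c2 = 0"
      using \<omega>(1) pos by (intro IVT') (auto intro!: F_cont continuous_intros)
    then show ?thesis by force
  next
    case False
    then have "\<exists>c2\<ge>c0. c2 \<le> c1 \<and> F (1 / \<omega>) (real l) c2 = 0"
      using \<omega>(1) pos by (intro IVT2') (auto intro!: F_cont continuous_intros)
    then show ?thesis by force
  qed
  then obtain c2 where c2: "\<bar>c2 - c0\<bar> \<le> \<bar>c1 - c0\<bar>" "F (1 / \<omega>) (real l) c2 = 0" by blast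
  have "(real l * \<omega>, c2 * \<omega>) \<in> bdry_pm \<omega> s \<sigma>" using F_mem[of \<omega> "real l" c2] c2(2) \<omega>0 \<omega>(3) by simp
  moreover have "(real l * \<omega>, c2 * \<omega>) \<in> axis \<omega> (int l)" by (simp add: axis_def)
  moreover have "(real l * \<omega>, c2 * \<omega>) \<in> U" using dW[of \<omega> c2] c2(1) c1(1) \<eta>(4) \<omega>(3,5) by simp
  ultimately show False using empty[OF \<omega>(3,4)] by blast
qed

end
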